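(* Let $V:[0,\infty)\to\mathbb{R}\cup\{+\infty\}$ satisfy the hypotheses (H1), (H2), (H3) stated in the context, and let $\mathcal{E}(x_1,\dots,x_N)=\sum_{i\neq j}V(|x_i-x_j|)$ for $x_1,\dots,x_N\in\mathbb{R}^2$. Assume in addition that $\mathcal{E}$ has crystallized ground states for every $N$. For each $N$ let $\{x_1^{(N)},\dots,x_N^{(N)}\}$ be any minimizing $N$-particle configuration of $\mathcal{E}$, and let $$\mu_N=\frac1N\sum_{i=1}^N\delta_{x_i^{(N)}/\sqrt N}$$ be the associated re-scaled empirical measure. Then, as $N\to\infty$, up to translation and rotation (that is, up to replacing $\mu_N$ by $\mu_N(R_N\,\cdot\,+a_N)$ for some rotation $R_N\in SO(2)$ and some translation vector $a_N\in\mathbb{R}^2$), $\mu_N$ converges weak* in $\mathcal{M}(\mathbb{R}^2)$ to the limit measure $$\mu=\frac{2}{\sqrt3}\,\chi_{\overline h}$$ (the measure with this density with respect to Lebesgue measure), where $\overline h$ is the regular hexagon $$\overline h=\operatorname{conv}\Bigl\{\pm\tfrac1{\sqrt3}e_1,\ \pm\tfrac1{\sqrt3}e_2,\ \pm\tfrac1{\sqrt3}(e_2-e_1)\Bigr\},\qquad e_1=(1,0),\quad e_2=\tfrac12(1,\sqrt3).$$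
   Context: Hypotheses on $V$: (H1) $V(1)=-1$ and $V(r)>-1$ for all $r\ne1$. (H2) There exist constants $\alpha\in(0,1]$, $\beta\in[1,\infty)$ such that $V(r)=+\infty$ for $r<\alpha$, $V(r)=0$ for $r>\beta$, and $V$ is continuous on $(\alpha,\beta)$. (H3) The constants $\alpha,\beta$ from (H2) are such that the (closed) ball of radius $\beta$ contains at most six points whose distance from the center and whose mutual distances are all $\ge\alpha$. The sum $\sum_{i\ne j}$ runs over ordered pairs, so each pair of particles is counted twice. The energy $\mathcal{E}:(\mathbb{R}^2)^N\to\mathbb{R}\cup\{+\infty\}$ is said to have crystallized ground states if its infimum is attained and any minimizer, after translation and rotation, is a subset of the triangular lattice $\mathcal{L}=\{me_1+ne_2:m,n\in\mathbb{Z}\}$ with $e_1=(1,0)$, $e_2=\frac12(1,\sqrt3)$. $\mathcal{M}(\mathbb{R}^2)$ is the space of Radon measures on $\mathbb{R}^2$ of finite mass, the dual of the space $C_0(\mathbb{R}^2)$ of continuous functions tending to $0$ at infinity; $\mu_N$ converges weak* to $\mu$ if $\int f\,d\mu_N\to\int f\,d\mu$ for all $f\in C_0(\mathbb{R}^2)$. $\mu_N(R\,\cdot\,+a)$ denotes the measure $A\mapsto\mu_N(RA+a)$. $\operatorname{conv}$ denotes convex hull and $\chi_{\overline h}$ the characteristic function of $\overline h$. *)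

theory Defs
  imports "HOL-Probability.Probability"
begin

text \<open>Potentials are functions \<^typ>\<open>real \<Rightarrow> ereal\<close>, of which only the values on the
  nonnegative reals matter.\<close>

definition normalized_well :: "(real \<Rightarrow> ereal) \<Rightarrow> bool" where
  "normalized_well V \<longleftrightarrow> V 1 = -1 \<and> (\<forall>r\<ge>0. r \<noteq> 1 \<longrightarrow> V r > -1)"

text \<open>Continuity on the open interval is with respect to the topology of the extended reals.\<close>

definition hard_core_finite_range :: "real \<Rightarrow> real \<Rightarrow> (real \<Rightarrow> ereal) \<Rightarrow> bool" where
  "hard_core_finite_range \<alpha> \<beta> V \<longleftrightarrow>
     0 < \<alpha> \<and> \<alpha> \<le> 1 \<and> 1 \<le> \<beta> \<and>
     (\<forall>r\<ge>0. r < \<alpha> \<longrightarrow> V r = \<infinity>) \<and> (\<forall>r>\<beta>. V r = 0) \<and>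
     continuous_on {\<alpha><..<\<beta>} V"

definition at_most_six_neighbours :: "real \<Rightarrow> real \<Rightarrow> bool" where
  "at_most_six_neighbours \<alpha> \<beta> \<longleftrightarrow>
     (\<forall>S \<subseteq> cball (0 :: real^2) \<beta>.
        (\<forall>p\<in>S. dist 0 p \<ge> \<alpha>) \<and> (\<forall>p\<in>S. \<forall>q\<in>S. p \<noteq> q \<longrightarrow> dist p q \<ge> \<alpha>)
        \<longrightarrow> finite S \<and> card S \<le> 6)"

text \<open>An \<open>N\<close>-particle configuration is a function on \<^typ>\<open>nat\<close> of which only the values at
  indices below \<open>N\<close> matter.\<close>

definition energy :: "(real \<Rightarrow> ereal) \<Rightarrow> nat \<Rightarrow> (nat \<Rightarrow> real^2) \<Rightarrow> ereal" where
  "energy V N x = (\<Sum>(i, j) \<in> {(i, j). i < N \<and> j < N \<and> i \<noteq> j}. V (norm (x i - x j)))"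

definition minimizer :: "(real \<Rightarrow> ereal) \<Rightarrow> nat \<Rightarrow> (nat \<Rightarrow> real^2) \<Rightarrow> bool" where
  "minimizer V N x \<longleftrightarrow> energy V N x = (INF y. energy V N y)"

definition e1 :: "real^2" where "e1 = vector [1, 0]"

definition e2 :: "real^2" where "e2 = (1/2) *\<^sub>R vector [1, sqrt 3]"

definition triangular_lattice :: "(real^2) set" where
  "triangular_lattice = {of_int m *\<^sub>R e1 + of_int n *\<^sub>R e2 | m n :: int. True}"

definition crystallized_ground_states :: "(real \<Rightarrow> ereal) \<Rightarrow> nat \<Rightarrow> bool" where
  "crystallized_ground_states V N \<longleftrightarrow>
     (\<exists>x. minimizer V N x) \<and>
     (\<forall>x. minimizer V N x \<longrightarrow>
        (\<exists>R a. rotation_matrix R \<and> (\<lambda>p. R *v p + a) ` x ` {..<N} \<subseteq> triangular_lattice))"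

definition empirical_measure :: "nat \<Rightarrow> (nat \<Rightarrow> real^2) \<Rightarrow> (real^2) measure" where
  "empirical_measure N x =
     distr (uniform_count_measure {..<N}) borel (\<lambda>i. x i /\<^sub>R sqrt (real N))"

text \<open>The empirical measure is the average of the Dirac measures at the rescaled particles,
  counted with multiplicity.\<close>

lemma emeasure_empirical_measure:
  assumes "A \<in> sets borel"
  shows "emeasure (empirical_measure N x) A =
    (\<Sum>i<N. emeasure (return borel (x i /\<^sub>R sqrt (real N))) A) / of_nat N"
proof -
  have ms: "(\<lambda>i. x i /\<^sub>R sqrt (real N)) \<in> uniform_count_measure {..<N} \<rightarrow>\<^sub>M borel"
    by (auto simp: measurable_def space_uniform_count_measure sets_uniform_count_measure)
  let ?S = "{i\<in>{..<N}. x i /\<^sub>R sqrt (real N) \<in> A}"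
  have "emeasure (empirical_measure N x) A = emeasure (uniform_count_measure {..<N}) ?S"
    unfolding empirical_measure_def
    by (subst emeasure_distr[OF ms assms])
      (auto simp: space_uniform_count_measure intro!: arg_cong[where f="emeasure _"])
  also have "\<dots> = ennreal (real (card ?S) / real N)"
    by (subst emeasure_uniform_count_measure) auto
  also have "\<dots> = of_nat (card ?S) / of_nat N"
    by (cases "N = 0") (auto simp: divide_ennreal[symmetric] ennreal_of_nat_eq_real_of_nat)
  also have "of_nat (card ?S) =
      (\<Sum>i<N. emeasure (return borel (x i /\<^sub>R sqrt (real N))) A)"
    using assms by (simp add: indicator_def sum.If_cases Int_def)
  finally show ?thesis .
qed

text \<open>The measure \<open>A \<mapsto> M (R A + a)\<close>, realised as the image of \<open>M\<close> under the inverse rigid motion.\<close>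

definition move_measure :: "real^2^2 \<Rightarrow> real^2 \<Rightarrow> (real^2) measure \<Rightarrow> (real^2) measure" where
  "move_measure R a M = distr M borel (\<lambda>y. matrix_inv R *v (y - a))"

lemma emeasure_move_measure:
  assumes "rotation_matrix R" "sets M = sets borel" "A \<in> sets borel"
  shows "emeasure (move_measure R a M) A = emeasure M ((\<lambda>z. R *v z + a) ` A)"
proof -
  have orth: "orthogonal_matrix R"
    using assms(1) by (simp add: rotation_matrix_def)
  then have "\<exists>B. R ** B = mat 1 \<and> B ** R = mat 1"
    by (auto simp: orthogonal_matrix_def)
  then have "R ** matrix_inv R = mat 1 \<and> matrix_inv R ** R = mat 1"
    unfolding matrix_inv_def by (rule someI_ex)
  then have eq: "matrix_inv R *v (R *v z) = z" "R *v (matrix_inv R *v z) = z" for z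
    by (simp_all add: matrix_vector_mul_assoc)
  have "(\<lambda>y. matrix_inv R *v (y - a)) \<in> M \<rightarrow>\<^sub>M borel"
    by (subst measurable_cong_sets[OF assms(2) refl])
      (intro borel_measurable_continuous_onI continuous_on_compose2[OF matrix_vector_mult_linear_continuous_on[of UNIV]]
        continuous_intros subset_UNIV)
  then have "emeasure (move_measure R a M) A =
      emeasure M ((\<lambda>y. matrix_inv R *v (y - a)) -` A \<inter> space M)"
    unfolding move_measure_def using assms(3) by (simp add: emeasure_distr)
  also have "(\<lambda>y. matrix_inv R *v (y - a)) -` A \<inter> space M = (\<lambda>z. R *v z + a) ` A"
  proof -
    have "y \<in> (\<lambda>z. R *v z + a) ` A" if "matrix_inv R *v (y - a) \<in> A" for y
      by (rule image_eqI[OF _ that]) (simp add: eq)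
    then show ?thesis
      using sets_eq_imp_space_eq[OF assms(2)] by (auto simp: eq)
  qed
  finally show ?thesis .
qed

text \<open>On the plane every finite Borel measure is a Radon measure, so these are the nonnegative
  elements of the dual of \<open>C\<^sub>0\<close>.\<close>

definition finite_radon_measures :: "(real^2) measure set" where
  "finite_radon_measures = {M. sets M = sets borel \<and> finite_measure M}"

definition C0 :: "(real^2 \<Rightarrow> real) set" where
  "C0 = {f. continuous_on UNIV f \<and> (f \<longlongrightarrow> 0) at_infinity}"

definition weak_star_converges :: "(nat \<Rightarrow> (real^2) measure) \<Rightarrow> (real^2) measure \<Rightarrow> bool" where
  "weak_star_converges M \<mu> \<longleftrightarrow>
     (\<forall>n. M n \<in> finite_radon_measures) \<and> \<mu> \<in> finite_radon_measures \<and>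
     (\<forall>f\<in>C0. (\<lambda>n. integral\<^sup>L (M n) f) \<longlonglongrightarrow> integral\<^sup>L \<mu> f)"

definition hexagon :: "(real^2) set" where
  "hexagon = convex hull
     {(1 / sqrt 3) *\<^sub>R e1, - (1 / sqrt 3) *\<^sub>R e1,
      (1 / sqrt 3) *\<^sub>R e2, - (1 / sqrt 3) *\<^sub>R e2,
      (1 / sqrt 3) *\<^sub>R (e2 - e1), - (1 / sqrt 3) *\<^sub>R (e2 - e1)}"

definition hexagon_measure :: "(real^2) measure" where
  "hexagon_measure = density lborel (\<lambda>z. ennreal (2 / sqrt 3 * indicator hexagon z))"

end

theory Submission
  imports Defs "HOL-Real_Asymp.Real_Asymp"
begin

text \<open>The hard core and the range of the potential force the energy of a lattice configuration to count
  its pairs at distance 1: the third hypothesis excludes a range of \<open>sqrt 3\<close> or more, the next distance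
  in the triangular lattice. By crystallization, a minimizer is therefore a set of \<open>N\<close> lattice points
  with the largest possible number of bonds (\<open>minimizer_bond_maximal\<close>), or equivalently with the
  smallest possible edge perimeter.

  The shape of such a set \<open>S\<close> is found by elementary counting. The lattice is covered by lines in three
  ways, one for each bond direction. The perimeter of \<open>S\<close> is at least \<open>2 (a + b + c)\<close>, where \<open>a\<close>, \<open>b\<close>, \<open>c\<close>
  are the numbers of lines of each kind that meet \<open>S\<close>. In each direction these lines are consecutive,
  because a gap could be closed by a translation that gains a bond (\<open>bond_maximal_no_gap\<close>). So \<open>S\<close> lies in
  a lattice hexagon bounded by three strips of widths \<open>a\<close>, \<open>b\<close>, \<open>c\<close>, and counting its points bounds \<open>N\<close>
  by the perimeter, minus squares that measure the deviation of the three strips from a regular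
  hexagon (\<open>card_le_of_projections\<close>). An explicit competitor (\<open>exists_small_perimeter\<close>) shows that
  \<open>a + b + c\<close> exceeds its lower bound by at most a constant, so these squares are of order \<open>sqrt N\<close>, and \<open>S\<close>
  is contained in a regular hexagon of radius \<open>sqrt (N / 3) + O(N\<^sup>1\<^sup>/\<^sup>4)\<close> (\<open>bond_maximal_near_hexagon\<close>).

  Containment is enough for convergence. After rescaling, the unit cells at the points of \<open>S\<close> are
  disjoint, have total area \<open>sqrt 3 / 2\<close>, and lie in a hexagon slightly larger than the limiting one,
  whose area is also \<open>sqrt 3 / 2\<close>; there is thus no room for them to leave any sizeable part of the
  hexagon empty. Formally, comparing sums over sites with integrals over cells gives an asymptotic upper
  bound for the averages of a nonnegative continuous function (\<open>eventually_site_average_le\<close>). Applying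
  it to \<open>B + f\<close> and \<open>B - f\<close>, for a bound \<open>B\<close> of \<open>\<bar>f\<bar>\<close> near the hexagon, gives convergence.\<close>

section \<open>Bonds, perimeter and lattice lines\<close>

text \<open>A point of the triangular lattice is represented by its pair of coefficients with respect to
  \<open>e1\<close> and \<open>e2\<close>; the six unit vectors of the lattice are then the following pairs.\<close>

definition hex_dirs :: "(int \<times> int) set" where
  "hex_dirs = {(1,0), (0,1), (-1,1), (-1,0), (0,-1), (1,-1)}"

text \<open>Bonds are counted as ordered pairs, as in the energy.\<close>

definition bond_pairs :: "(int \<times> int) set \<Rightarrow> ((int \<times> int) \<times> (int \<times> int)) set" where
  "bond_pairs S = {(p, q). p \<in> S \<and> q \<in> S \<and> q - p \<in> hex_dirs}"

definition exits :: "(int \<times> int) set \<Rightarrow> int \<times> int \<Rightarrow> (int \<times> int) set" where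
  "exits S u = {p\<in>S. p + u \<notin> S}"

definition perimeter :: "(int \<times> int) set \<Rightarrow> nat" where
  "perimeter S = (\<Sum>u\<in>hex_dirs. card (exits S u))"

definition bond_maximal :: "(int \<times> int) set \<Rightarrow> bool" where
  "bond_maximal S \<longleftrightarrow> finite S \<and>
     (\<forall>T. finite T \<and> card T = card S \<longrightarrow> card (bond_pairs T) \<le> card (bond_pairs S))"

lemma finite_hex_dirs [simp]: "finite hex_dirs"
  by (simp add: hex_dirs_def)

lemma card_hex_dirs: "card hex_dirs = 6"
  by (simp add: hex_dirs_def)

lemma sum_hex_dirs:
  "(\<Sum>u\<in>hex_dirs. f u) = f (1,0) + f (0,1) + f (-1,1) + f (-1,0) + f (0,-1) + f (1,-1)"
  for f :: "int \<times> int \<Rightarrow> nat"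
  by (simp add: hex_dirs_def)

lemma finite_bond_pairs: "finite S \<Longrightarrow> finite (bond_pairs S)"
  by (rule finite_subset[of _ "S \<times> S"]) (auto simp: bond_pairs_def)

lemma finite_obtains_argmax:
  fixes f :: "'a \<Rightarrow> int"
  assumes "finite A" "A \<noteq> {}"
  obtains q where "q \<in> A" "\<And>r. r \<in> A \<Longrightarrow> f r \<le> f q"
proof -
  have "Max (f ` A) \<in> f ` A"
    using assms by (intro Max_in) auto
  then obtain q where "q \<in> A" "f q = Max (f ` A)"
    by auto
  then show ?thesis
    using assms that[of q] by simp
qed

text \<open>Each point has six neighbouring sites, each of which is either a point of the set, giving a bond,
  or not, giving a unit of perimeter. Maximizing bonds therefore means minimizing the perimeter.\<close>

lemma bonds_plus_perimeter:
  assumes "finite S"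
  shows "card (bond_pairs S) + perimeter S = 6 * card S"
proof -
  let ?stay = "\<lambda>u. {p\<in>S. p + u \<in> S}"
  have "bond_pairs S = (\<lambda>(u, p). (p, p + u)) ` (SIGMA u:hex_dirs. ?stay u)"
    by (force simp: bond_pairs_def image_iff)
  moreover have "inj_on (\<lambda>(u, p). (p, p + u)) (SIGMA u:hex_dirs. ?stay u)"
    by (auto simp: inj_on_def)
  ultimately have "card (bond_pairs S) = (\<Sum>u\<in>hex_dirs. card (?stay u))"
    using assms by (simp add: card_image)
  moreover have "card (?stay u) + card (exits S u) = card S" for u
    using assms unfolding exits_def by (subst card_Un_disjoint[symmetric]) (auto intro: arg_cong[where f=card])
  ultimately show ?thesis
    by (simp add: perimeter_def card_hex_dirs flip: sum.distrib)
qed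

text \<open>The determinant of \<open>u\<close> and \<open>p\<close>; its level sets are the lattice lines in direction \<open>u\<close>.\<close>

definition line_of :: "int \<times> int \<Rightarrow> int \<times> int \<Rightarrow> int" where
  "line_of u p = fst u * snd p - snd u * fst p"

text \<open>Every line that meets the set contains a last point in direction \<open>u\<close>, from which one exits.\<close>

lemma lines_le_exits:
  assumes S: "finite S" and u: "u \<noteq> 0"
  shows "card (line_of u ` S) \<le> card (exits S u)"
proof -
  have "line_of u p \<in> line_of u ` exits S u" if "p \<in> S" for p
  proof -
    let ?g = "\<lambda>q. fst u * fst q + snd u * snd q"
    let ?A = "{q\<in>S. line_of u q = line_of u p}"
    have "finite ?A"
      using S by simp
    moreover have "?A \<noteq> {}"
      using that by blast
    ultimately obtain q where q: "q \<in> ?A" and max: "\<And>r. r \<in> ?A \<Longrightarrow> ?g r \<le> ?g q"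
      by (rule finite_obtains_argmax[where f = ?g]) blast
    have "fst u * fst u + snd u * snd u > 0"
      using u by (auto simp: prod_eq_iff sum_squares_gt_zero_iff)
    then have "\<not> ?g (q + u) \<le> ?g q"
      by (simp add: algebra_simps)
    moreover have "line_of u (q + u) = line_of u q"
      by (simp add: line_of_def algebra_simps)
    ultimately have "q + u \<notin> S"
      using max[of "q + u"] q by auto
    then show ?thesis
      using q by (intro image_eqI[of _ _ q]) (auto simp: exits_def)
  qed
  then have "line_of u ` S \<subseteq> line_of u ` exits S u"
    by auto
  moreover have "finite (exits S u)"
    using S by (simp add: exits_def)
  ultimately show ?thesis
    by (meson card_image_le card_mono finite_imageI le_trans)
qed

lemma same_line:
  assumes "u \<in> hex_dirs" "line_of u p = line_of u q"
  shows "\<exists>j. q = (fst p + j * fst u, snd p + j * snd u)"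
proof -
  have "u \<in> {(1,0), (0,1), (-1,1), (-1,0), (0,-1), (1,-1)}"
    using assms(1) by (simp add: hex_dirs_def)
  then show ?thesis
    using assms(2)
    apply (elim insertE emptyE)
         apply (simp_all add: line_of_def prod_eq_iff)
    apply presburger+
    done
qed

text \<open>If the set meets every line in direction \<open>u\<close> in a contiguous segment, then one exits only once
  from each line, so that the bound of \<open>lines_le_exits\<close> is attained.\<close>

lemma exits_le_lines:
  assumes S: "finite S" and u: "u \<in> hex_dirs"
    and conv: "\<And>p j. \<lbrakk>p \<in> S; (fst p + j * fst u, snd p + j * snd u) \<in> S; j \<ge> 1\<rbrakk> \<Longrightarrow> p + u \<in> S"
  shows "card (exits S u) \<le> card (line_of u ` S)"
proof -
  have "inj_on (line_of u) (exits S u)"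
  proof (rule inj_onI)
    fix p q assume p: "p \<in> exits S u" and q: "q \<in> exits S u" and "line_of u p = line_of u q"
    then obtain j where j: "q = (fst p + j * fst u, snd p + j * snd u)"
      using same_line[OF u] by blast
    then have p_eq: "p = (fst q + (-j) * fst u, snd q + (-j) * snd u)"
      by simp
    have "\<not> j \<ge> 1"
      using conv[of p j] p q j by (auto simp: exits_def)
    moreover have "\<not> - j \<ge> 1"
      using conv[of q "-j"] p q p_eq by (auto simp: exits_def)
    ultimately have "j = 0" by linarith
    then show "p = q" using j by simp
  qed
  then have "card (exits S u) = card (line_of u ` exits S u)"
    by (simp add: card_image)
  also have "\<dots> \<le> card (line_of u ` S)"
    using S by (intro card_mono) (auto simp: exits_def)
  finally show ?thesis .
qed

text \<open>The three families of lattice lines are the level sets of the two coordinates and of their sum.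
  Each of them is met by the exits in two opposite directions.\<close>

lemma perimeter_ge_lines:
  assumes "finite S"
  shows "2 * (card (fst ` S) + card (snd ` S) + card ((\<lambda>p. fst p + snd p) ` S)) \<le> perimeter S"
proof -
  have neg: "card ((\<lambda>p. - f p) ` S) = card (f ` S)" for f :: "int \<times> int \<Rightarrow> int"
    using card_image[of uminus "f ` S"] by (simp add: image_image)
  have eqs: "line_of (1,0) = snd" "line_of (-1,0) = (\<lambda>p. - snd p)"
    "line_of (0,1) = (\<lambda>p. - fst p)" "line_of (0,-1) = fst"
    "line_of (-1,1) = (\<lambda>p. - (fst p + snd p))" "line_of (1,-1) = (\<lambda>p. fst p + snd p)"
    by (auto simp: line_of_def fun_eq_iff)
  have le: "card (line_of u ` S) \<le> card (exits S u)" if "u \<in> hex_dirs" for u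
    using that assms by (intro lines_le_exits) (auto simp: hex_dirs_def zero_prod_def)
  show ?thesis
    unfolding perimeter_def sum_hex_dirs
    using le[of "(1,0)"] le[of "(0,1)"] le[of "(-1,1)"] le[of "(-1,0)"] le[of "(0,-1)"] le[of "(1,-1)"]
    unfolding eqs neg by (simp add: hex_dirs_def)
qed

section \<open>Bond-maximal sets have no gaps\<close>

text \<open>If the level \<open>k\<close> were skipped, the part of the set beyond it could be translated so that one of its
  points becomes a neighbour of a point on the near side. This keeps all bonds and creates a new one.
  The functional \<open>\<phi>\<close> will be either coordinate or their sum.\<close>

lemma bond_maximal_no_gap:
  fixes \<phi> :: "int \<times> int \<Rightarrow> int"
  assumes S: "bond_maximal S"
    and add: "\<And>p q. \<phi> (p + q) = \<phi> p + \<phi> q"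
    and le1: "\<And>u. u \<in> hex_dirs \<Longrightarrow> \<bar>\<phi> u\<bar> \<le> 1"
    and u: "u \<in> hex_dirs" "\<phi> u = 1"
    and lo: "p0 \<in> S" "\<phi> p0 < k" and hi: "p1 \<in> S" "k < \<phi> p1"
  shows "k \<in> \<phi> ` S"
proof (rule ccontr)
  assume gap: "k \<notin> \<phi> ` S"
  have diff: "\<phi> (p - q) = \<phi> p - \<phi> q" for p q
    using add[of "p - q" q] by simp
  have fin: "finite S"
    using S by (simp add: bond_maximal_def)
  define A where "A = {p\<in>S. \<phi> p < k}"
  define B where "B = {p\<in>S. \<phi> p > k}"
  have AB: "S = A \<union> B" "A \<inter> B = {}" "finite A" "finite B"
    using gap fin by (auto simp: A_def B_def)
  have ne: "A \<noteq> {}" "B \<noteq> {}"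
    using lo hi unfolding A_def B_def by blast+
  obtain q where q: "q \<in> A" "\<And>p. p \<in> A \<Longrightarrow> \<phi> p \<le> \<phi> q"
    using finite_obtains_argmax[OF AB(3) ne(1), of \<phi>] by blast
  obtain r where r: "r \<in> B" "\<And>p. p \<in> B \<Longrightarrow> \<phi> r \<le> \<phi> p"
    using finite_obtains_argmax[OF AB(4) ne(2), of "\<lambda>p. - \<phi> p"] by auto
  define v where "v = q + u - r"
  define B' where "B' = (\<lambda>p. p + v) ` B"
  have B'_gt: "\<phi> p > \<phi> q" if "p \<in> B'" for p
    using that r u(2) by (fastforce simp: B'_def v_def add diff)
  have disj: "A \<inter> B' = {}"
    using B'_gt q(2) by fastforce
  have card_B': "card B' = card B" "finite B'"
    using AB(4) by (simp_all add: B'_def card_image)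
  have "card (A \<union> B') = card S"
    using AB disj card_B' by (simp add: card_Un_disjoint)
  then have max: "card (bond_pairs (A \<union> B')) \<le> card (bond_pairs S)"
    using S AB(3) card_B' by (simp add: bond_maximal_def)
  \<comment> \<open>No bond of \<open>S\<close> crosses the gap, since \<open>\<phi>\<close> changes by at most one along a bond.\<close>
  have split: "bond_pairs S = bond_pairs A \<union> bond_pairs B"
  proof -
    have False if "p \<in> A" "p' \<in> B" "p' - p \<in> hex_dirs \<or> p - p' \<in> hex_dirs" for p p'
      using that le1[of "p' - p"] le1[of "p - p'"] by (auto simp: A_def B_def diff)
    then show ?thesis
      unfolding AB(1) bond_pairs_def by blast
  qed
  let ?sh = "\<lambda>(p, p'). (p + v, p' + v)"
  have "card (bond_pairs S) = card (bond_pairs A) + card (bond_pairs B)"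
    unfolding split using AB by (intro card_Un_disjoint finite_bond_pairs) (auto simp: bond_pairs_def)
  also have "card (bond_pairs B) = card (?sh ` bond_pairs B)"
    by (rule card_image[symmetric]) (auto simp: inj_on_def)
  also have "card (bond_pairs A) + \<dots> = card (bond_pairs A \<union> ?sh ` bond_pairs B)"
    using AB disj by (intro card_Un_disjoint[symmetric] finite_bond_pairs finite_imageI)
      (auto simp: bond_pairs_def B'_def)
  also have "\<dots> < card (insert (q, q + u) (bond_pairs A \<union> ?sh ` bond_pairs B))"
  proof -
    have "q + u \<in> B'"
      using r(1) by (auto simp: B'_def v_def image_iff intro!: bexI[of _ r])
    then have "(q, q + u) \<notin> bond_pairs A \<union> ?sh ` bond_pairs B"
      using disj q(1) by (auto simp: bond_pairs_def B'_def)
    then show ?thesis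
      using AB by (simp add: finite_bond_pairs)
  qed
  also have "\<dots> \<le> card (bond_pairs (A \<union> B'))"
  proof (rule card_mono)
    show "finite (bond_pairs (A \<union> B'))"
      using AB card_B' by (simp add: finite_bond_pairs)
    have "q + u \<in> B'"
      using r(1) by (auto simp: B'_def v_def image_iff intro!: bexI[of _ r])
    then show "insert (q, q + u) (bond_pairs A \<union> ?sh ` bond_pairs B) \<subseteq> bond_pairs (A \<union> B')"
      using q(1) u(1) by (auto simp: bond_pairs_def B'_def)
  qed
  finally show False using max by simp
qed

lemma bond_maximal_interval:
  fixes \<phi> :: "int \<times> int \<Rightarrow> int"
  assumes S: "bond_maximal S" "S \<noteq> {}"
    and add: "\<And>p q. \<phi> (p + q) = \<phi> p + \<phi> q"
    and le1: "\<And>u. u \<in> hex_dirs \<Longrightarrow> \<bar>\<phi> u\<bar> \<le> 1"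
    and u: "u \<in> hex_dirs" "\<phi> u = 1"
  shows "\<exists>l. \<phi> ` S = {l..<l + int (card (\<phi> ` S))}"
proof -
  have fin: "finite (\<phi> ` S)" and ne: "\<phi> ` S \<noteq> {}"
    using S by (auto simp: bond_maximal_def)
  define l h where "l = Min (\<phi> ` S)" and "h = Max (\<phi> ` S)"
  have lh: "l \<in> \<phi> ` S" "h \<in> \<phi> ` S"
    using fin ne by (auto simp only: l_def h_def intro: Min_in Max_in)
  have "\<phi> ` S = {l..h}"
  proof
    show "\<phi> ` S \<subseteq> {l..h}"
      using fin by (auto simp: l_def h_def)
    show "{l..h} \<subseteq> \<phi> ` S"
    proof
      fix k assume k: "k \<in> {l..h}"
      show "k \<in> \<phi> ` S"
      proof (cases "k = l \<or> k = h")
        case False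
        obtain p0 p1 where "p0 \<in> S" "\<phi> p0 = l" "p1 \<in> S" "\<phi> p1 = h"
          using lh by auto
        then show ?thesis
          using bond_maximal_no_gap[OF S(1) add le1 u, of p0 k p1] k False by auto
      qed (use lh in auto)
    qed
  qed
  moreover have "l \<le> h" using lh fin by (simp add: l_def)
  ultimately show ?thesis
    by (intro exI[of _ l]) auto
qed

section \<open>A competitor of small perimeter\<close>

definition lattice_hexagon :: "nat \<Rightarrow> (int \<times> int) set" where
  "lattice_hexagon k =
     {p. \<bar>fst p\<bar> \<le> int k \<and> \<bar>snd p\<bar> \<le> int k \<and> \<bar>fst p + snd p\<bar> \<le> int k}"

lemma finite_lattice_hexagon: "finite (lattice_hexagon k)"
  by (rule finite_subset[of _ "{- int k..int k} \<times> {- int k..int k}"])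
    (auto simp: lattice_hexagon_def)

text \<open>The lattice hexagon contains three disjoint rhombi of \<open>k\<^sup>2\<close> points each, spanned by every second
  vertex.\<close>

lemma card_lattice_hexagon_ge: "3 * k\<^sup>2 \<le> card (lattice_hexagon k)"
proof -
  let ?P = "{1..int k} \<times> {0..<int k}"
  define R1 R2 R3 where "R1 = (\<lambda>(s, t). (s - t, t)) ` ?P"
    and "R2 = (\<lambda>(s, t). (- s, s - t)) ` ?P" and "R3 = (\<lambda>(s, t). (t, - s)) ` ?P"
  have card: "card R1 = k\<^sup>2" "card R2 = k\<^sup>2" "card R3 = k\<^sup>2"
    unfolding R1_def R2_def R3_def
    by (subst card_image; auto simp: inj_on_def card_cartesian_product power2_eq_square)+
  have fin: "finite R1" "finite R2" "finite R3"
    by (simp_all add: R1_def R2_def R3_def)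
  have "R1 \<inter> R2 = {}" "(R1 \<union> R2) \<inter> R3 = {}"
    by (auto simp: R1_def R2_def R3_def)
  then have "3 * k\<^sup>2 = card (R1 \<union> R2 \<union> R3)"
    using card fin by (simp add: card_Un_disjoint)
  also have "\<dots> \<le> card (lattice_hexagon k)"
    by (intro card_mono finite_lattice_hexagon) (auto simp: R1_def R2_def R3_def lattice_hexagon_def)
  finally show ?thesis .
qed

lemma initial_segment_of_card:
  fixes w :: "'a \<Rightarrow> int"
  assumes "finite H" "inj_on w H" "N \<le> card H"
  shows "\<exists>t. card {p\<in>H. w p < t} = N"
  using assms(3)
proof (induction N)
  case 0
  show ?case
  proof (cases "H = {}")
    case False
    obtain q where q: "q \<in> H" "\<And>r. r \<in> H \<Longrightarrow> - w r \<le> - w q"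
      by (rule finite_obtains_argmax[OF assms(1) False, of "\<lambda>p. - w p"]) blast
    then have "{p\<in>H. w p < w q} = {}"
      by (auto simp: not_less)
    then have "card {p\<in>H. w p < w q} = 0"
      by (simp only: card.empty)
    then show ?thesis ..
  qed simp
next
  case (Suc N)
  then obtain t where t: "card {p\<in>H. w p < t} = N" by auto
  let ?R = "{p\<in>H. \<not> w p < t}"
  have "?R \<noteq> {}"
  proof
    assume "?R = {}"
    then have "{p\<in>H. w p < t} = H" by auto
    with t Suc.prems show False by simp
  qed
  moreover have "finite ?R"
    using assms(1) by simp
  ultimately obtain q where q: "q \<in> ?R" "\<And>r. r \<in> ?R \<Longrightarrow> - w r \<le> - w q"
    using finite_obtains_argmax[of ?R "\<lambda>p. - w p"] by blast
  have "{p\<in>H. w p < w q + 1} = insert q {p\<in>H. w p < t}"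
  proof (intro set_eqI iffI)
    fix p assume p: "p \<in> {p\<in>H. w p < w q + 1}"
    show "p \<in> insert q {p\<in>H. w p < t}"
    proof (cases "w p < t")
      case False
      then have "w p = w q" using q(2)[of p] p by auto
      then show ?thesis using assms(2) p q(1) by (auto dest: inj_onD)
    qed (use p in auto)
  qed (use q(1) in auto)
  moreover have "q \<notin> {p\<in>H. w p < t}"
    using q(1) by auto
  ultimately have "card {p\<in>H. w p < w q + 1} = Suc N"
    using t assms(1) by simp
  then show ?case by blast
qed

text \<open>The competitor is obtained by filling the hexagon of side \<open>k\<close> row by row until it has \<open>N\<close> points.
  Being the intersection of the lattice with half-planes, it meets every line contiguously, and it
  meets at most \<open>2 k + 1\<close> lines of each direction.\<close>

lemma exists_small_perimeter:
  assumes N: "N \<le> 3 * k\<^sup>2"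
  shows "\<exists>T. finite T \<and> card T = N \<and> perimeter T \<le> 6 * (2 * k + 1)"
proof -
  \<comment> \<open>\<open>w\<close> orders the hexagon row by row, the first coordinate having \<open>2 k + 1\<close> possible values.\<close>
  define w where "w = (\<lambda>p. (2 * int k + 1) * snd p + fst p)"
  have "inj_on w (lattice_hexagon k)"
  proof (rule inj_onI)
    fix p q assume p: "p \<in> lattice_hexagon k" and q: "q \<in> lattice_hexagon k" and eq: "w p = w q"
    have e: "(2 * int k + 1) * (snd p - snd q) = fst q - fst p"
      using eq by (simp add: w_def algebra_simps)
    have "snd p = snd q"
    proof (rule ccontr)
      assume "snd p \<noteq> snd q"
      then have "(2 * int k + 1) * 1 \<le> (2 * int k + 1) * \<bar>snd p - snd q\<bar>"
        by (intro mult_left_mono) auto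
      also have "\<dots> = \<bar>fst q - fst p\<bar>"
        unfolding e[symmetric] by (simp add: abs_mult)
      finally show False using p q by (auto simp: lattice_hexagon_def)
    qed
    with e show "p = q" by (simp add: prod_eq_iff)
  qed
  moreover have "N \<le> card (lattice_hexagon k)"
    using N card_lattice_hexagon_ge le_trans by blast
  ultimately obtain t where t: "card {p\<in>lattice_hexagon k. w p < t} = N"
    using initial_segment_of_card finite_lattice_hexagon by blast
  define T where "T = {p\<in>lattice_hexagon k. w p < t}"
  have fin: "finite T"
    using finite_lattice_hexagon by (simp add: T_def)
  have "card (exits T u) \<le> 2 * k + 1" if u: "u \<in> hex_dirs" for u
  proof -
    have u': "u \<in> {(1,0), (0,1), (-1,1), (-1,0), (0,-1), (1,-1)}"
      using u by (simp add: hex_dirs_def)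
    have "p + u \<in> T"
      if p: "p \<in> T" and q: "(fst p + j * fst u, snd p + j * snd u) \<in> T" and j: "j \<ge> 1" for p j
    proof -
      have "p + u \<in> lattice_hexagon k"
        using u' p q j by (elim insertE emptyE) (auto simp: T_def lattice_hexagon_def)
      moreover have "w (p + u) < t"
      proof (cases "w u \<le> 0")
        case True
        have "w (p + u) = w p + w u" by (simp add: w_def algebra_simps)
        with True p show ?thesis by (simp add: T_def)
      next
        case False
        have "w (p + u) = w p + 1 * w u" by (simp add: w_def algebra_simps)
        also have "\<dots> \<le> w p + j * w u"
          using False j by (intro add_left_mono mult_right_mono) auto
        also have "\<dots> = w (fst p + j * fst u, snd p + j * snd u)"
          by (simp add: w_def algebra_simps)
        also have "\<dots> < t" using q by (simp add: T_def)
        finally show ?thesis .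
      qed
      ultimately show ?thesis by (simp add: T_def)
    qed
    then have "card (exits T u) \<le> card (line_of u ` T)"
      by (intro exits_le_lines fin u)
    also have "\<dots> \<le> card {- int k..int k}"
      using u' by (intro card_mono) (auto simp: line_of_def T_def lattice_hexagon_def)
    finally show ?thesis by simp
  qed
  then have "perimeter T \<le> (\<Sum>u\<in>hex_dirs. 2 * k + 1)"
    unfolding perimeter_def by (intro sum_mono)
  then have "perimeter T \<le> 6 * (2 * k + 1)"
    by (simp add: card_hex_dirs)
  with t fin show ?thesis
    unfolding T_def by blast
qed

section \<open>Bond-maximal sets are nearly regular hexagons\<close>

lemma card_lattice_triangle:
  fixes x y z :: int
  assumes "x + y \<le> z"
  shows "finite {p. x \<le> fst p \<and> y \<le> snd p \<and> fst p + snd p < z}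
    \<and> 2 * int (card {p. x \<le> fst p \<and> y \<le> snd p \<and> fst p + snd p < z}) = (z - x - y) * (z - x - y + 1)"
  using assms
proof (induction z rule: int_ge_induct)
  case base
  have "{p. x \<le> fst p \<and> y \<le> snd p \<and> fst p + snd p < x + y} = {}" by auto
  then show ?case by (simp only: card.empty) simp
next
  case (step z)
  let ?T = "\<lambda>z. {p. x \<le> fst p \<and> y \<le> snd p \<and> fst p + snd p < z}"
  let ?D = "(\<lambda>i. (i, z - i)) ` {x..z - y}"
  have D: "p \<in> ?D" if "x \<le> fst p" "y \<le> snd p" "fst p + snd p = z" for p
    using that by (intro image_eqI[of _ _ "fst p"]) (auto simp: prod_eq_iff)
  have eq: "?T (z + 1) = ?T z \<union> ?D"
  proof (intro set_eqI iffI)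
    fix p assume p: "p \<in> ?T (z + 1)"
    then show "p \<in> ?T z \<union> ?D"
      by (cases "fst p + snd p = z") (use D in \<open>simp, simp\<close>)
  qed auto
  have "card (?T (z + 1)) = card (?T z) + card ?D"
    unfolding eq using step by (intro card_Un_disjoint) auto
  also have "card ?D = nat (z - y - x + 1)"
    by (subst card_image) (auto simp: inj_on_def)
  finally have "2 * int (card (?T (z + 1))) = (z - x - y) * (z - x - y + 1) + 2 * (z - y - x + 1)"
    using step by simp
  moreover have "finite (?T (z + 1))"
    unfolding eq using step by simp
  ultimately show ?case
    by (simp add: algebra_simps)
qed

text \<open>The set lies in the rectangle given by the first two projections, minus the two opposite corner
  triangles that are cut off by the third. With \<open>s\<close> and \<open>t\<close> denoting the side lengths of the
  triangles, \<open>s + t + 1 = a + b - c\<close>, and the number of removed points, \<open>(s (s + 1) + t (t + 1)) / 2\<close>,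
  is smallest when \<open>s = t\<close>. The second term on the left is \<open>(s - t)\<^sup>2\<close>, the price of asymmetry.\<close>

lemma card_le_of_projections:
  fixes x y z a b c :: int
  assumes ne: "S \<noteq> {}" and fin: "finite S"
    and fst: "fst ` S = {x..<x + a}" and snd: "snd ` S = {y..<y + b}"
    and sum: "(\<lambda>p. fst p + snd p) ` S = {z..<z + c}"
  shows "4 * int (card S) + ((z - x - y) - (x + y + a + b - 1 - z - c))\<^sup>2 \<le> 4 * a * b - (a + b - c)\<^sup>2 + 1"
proof -
  define s t where "s = z - x - y" and "t = x + y + a + b - 1 - z - c"
  have "a > 0" "b > 0" "c > 0"
    using ne fst snd sum by (metis image_is_empty atLeastLessThan_empty_iff less_add_same_cancel1)+
  have mem: "x \<le> fst p" "fst p < x + a" "y \<le> snd p" "snd p < y + b"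
    "z \<le> fst p + snd p" "fst p + snd p < z + c" if "p \<in> S" for p
    using that fst snd sum by (metis imageI atLeastLessThan_iff)+
  have "x \<in> fst ` S" "x + a - 1 \<in> fst ` S" "y \<in> snd ` S" "y + b - 1 \<in> snd ` S"
    "z \<in> (\<lambda>p. fst p + snd p) ` S" "z + c - 1 \<in> (\<lambda>p. fst p + snd p) ` S"
    using \<open>a > 0\<close> \<open>b > 0\<close> \<open>c > 0\<close> unfolding fst snd sum by auto
  then obtain p1 p2 p3 p4 p5 p6 where
    "p1 \<in> S" "fst p1 = x" "p2 \<in> S" "fst p2 = x + a - 1" "p3 \<in> S" "snd p3 = y"
    "p4 \<in> S" "snd p4 = y + b - 1" "p5 \<in> S" "fst p5 + snd p5 = z"
    "p6 \<in> S" "fst p6 + snd p6 = z + c - 1"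
    by (auto simp del: split_paired_All split_paired_Ex)
  then have bnd: "0 \<le> s" "0 \<le> t" "s < a" "s < b" "t < a" "t < b"
    using mem[of p1] mem[of p2] mem[of p3] mem[of p4] mem[of p5] mem[of p6]
    by (auto simp: s_def t_def)
  define L where "L = {p. x \<le> fst p \<and> y \<le> snd p \<and> fst p + snd p < z}"
  define U where "U = uminus ` {p. 1 - x - a \<le> fst p \<and> 1 - y - b \<le> snd p \<and> fst p + snd p < 1 - z - c}"
  have "x + y \<le> z" "(1 - x - a) + (1 - y - b) \<le> 1 - z - c"
    using bnd by (auto simp: s_def t_def)
  note this[THEN card_lattice_triangle]
  then have tri: "finite L" "finite U" "2 * int (card L) = s * (s + 1)" "2 * int (card U) = t * (t + 1)"
    by (simp_all add: L_def U_def s_def t_def card_image algebra_simps)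
  have U_eq: "U = {p. fst p < x + a \<and> snd p < y + b \<and> z + c \<le> fst p + snd p}"
  proof (intro set_eqI iffI)
    fix p assume "p \<in> {p. fst p < x + a \<and> snd p < y + b \<and> z + c \<le> fst p + snd p}"
    then show "p \<in> U"
      unfolding U_def by (intro image_eqI[of _ _ "- p"]) auto
  qed (auto simp: U_def)
  have "card (S \<union> L \<union> U) = card S + card L + card U"
  proof -
    have "S \<inter> L = {}" "(S \<union> L) \<inter> U = {}"
      using mem(5,6) \<open>c > 0\<close> by (force simp: L_def U_eq)+
    then show ?thesis
      using fin tri(1,2) by (simp add: card_Un_disjoint)
  qed
  moreover have "card (S \<union> L \<union> U) \<le> card ({x..<x + a} \<times> {y..<y + b})"
  proof (rule card_mono)
    have "p \<in> {x..<x + a} \<times> {y..<y + b}" if "p \<in> S \<union> L \<union> U" for p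
      using that mem[of p] bnd by (cases p) (auto simp: L_def U_eq s_def t_def)
    then show "S \<union> L \<union> U \<subseteq> {x..<x + a} \<times> {y..<y + b}"
      by blast
  qed simp
  moreover have "int (card ({x..<x + a} \<times> {y..<y + b})) = a * b"
    using \<open>a > 0\<close> \<open>b > 0\<close> by (simp add: card_cartesian_product)
  ultimately have "int (card S) + int (card L) + int (card U) \<le> a * b"
    by linarith
  then have "4 * int (card S) + 2 * (s * (s + 1)) + 2 * (t * (t + 1)) \<le> 4 * (a * b)"
    using tri by linarith
  moreover have "2 * (s * (s + 1)) + 2 * (t * (t + 1)) = (s - t)\<^sup>2 + (s + t + 1)\<^sup>2 - 1"
    by (simp add: power2_eq_square algebra_simps)
  ultimately have "4 * int (card S) + (s - t)\<^sup>2 \<le> 4 * a * b - (s + t + 1)\<^sup>2 + 1"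
    by simp
  moreover have "s + t + 1 = a + b - c"
    by (simp add: s_def t_def)
  ultimately show ?thesis
    unfolding s_def t_def by metis
qed

text \<open>In lattice coordinates the regular hexagon around \<open>(u, v)\<close> is the intersection of three strips of
  half-width \<open>\<rho>\<close>.\<close>

definition near_hexagon :: "real \<Rightarrow> real \<Rightarrow> real \<Rightarrow> (int \<times> int) set \<Rightarrow> bool" where
  "near_hexagon \<rho> u v S \<longleftrightarrow> (\<forall>p\<in>S. \<bar>of_int (fst p) - u\<bar> \<le> \<rho> \<and> \<bar>of_int (snd p) - v\<bar> \<le> \<rho> \<and>
     \<bar>of_int (fst p) - u + (of_int (snd p) - v)\<bar> \<le> \<rho>)"

text \<open>The widths \<open>a\<close>, \<open>b\<close>, \<open>c\<close> of the three projections satisfy \<open>a + b + c \<le> sqrt (12 N) + O(1)\<close>, by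
  comparison with the competitor, while \<open>N\<close> points only fit between lines at these distances if
  \<open>(a + b + c)\<^sup>2\<close> is at least about \<open>12 N\<close>, with equality only for equal widths and a symmetric
  position of the third strip. The quadratic nature of the defect turns the error \<open>O(1)\<close> in the
  perimeter into an error of order \<open>N\<^sup>1\<^sup>/\<^sup>4\<close> in the widths.\<close>

lemma bond_maximal_near_hexagon:
  assumes S: "bond_maximal S" and N: "card S = N" "N \<ge> 1"
  shows "\<exists>u v. near_hexagon (sqrt (N / 3) + 8 * sqrt (sqrt N)) u v S"
proof -
  have fin: "finite S" and ne: "S \<noteq> {}"
    using S N by (auto simp: bond_maximal_def)
  define r q where "r = sqrt (N / 3)" and "q = sqrt (sqrt N)"
  have r: "r \<ge> 0" "r\<^sup>2 = N / 3" and q: "q \<ge> 1" "q\<^sup>2 = sqrt N" "(q\<^sup>2)\<^sup>2 = N"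
    using N by (auto simp: r_def q_def)
  \<comment> \<open>\<open>29/50\<close> is a rational upper bound of \<open>1 / sqrt 3\<close>.\<close>
  have rq: "r \<le> 29/50 * q\<^sup>2"
  proof (rule power2_le_imp_le)
    show "r\<^sup>2 \<le> (29/50 * q\<^sup>2)\<^sup>2"
      using N unfolding r(2) power_mult_distrib q(3) by (simp add: power2_eq_square)
  qed simp
  have qq: "1 \<le> q\<^sup>2"
    using q(1) by (rule one_le_power)

  define a b c where "a = int (card (fst ` S))" and "b = int (card (snd ` S))"
    and "c = int (card ((\<lambda>p. fst p + snd p) ` S))"
  have "\<exists>x. fst ` S = {x..<x + a}"
    unfolding a_def by (rule bond_maximal_interval[OF S ne, where u = "(1,0)"]) (auto simp: hex_dirs_def)
  then obtain x where x: "fst ` S = {x..<x + a}" ..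
  have "\<exists>y. snd ` S = {y..<y + b}"
    unfolding b_def by (rule bond_maximal_interval[OF S ne, where u = "(0,1)"]) (auto simp: hex_dirs_def)
  then obtain y where y: "snd ` S = {y..<y + b}" ..
  have "\<exists>z. (\<lambda>p. fst p + snd p) ` S = {z..<z + c}"
    unfolding c_def by (rule bond_maximal_interval[OF S ne, where u = "(0,1)"]) (auto simp: hex_dirs_def)
  then obtain z where z: "(\<lambda>p. fst p + snd p) ` S = {z..<z + c}" ..
  \<comment> \<open>Half of \<open>d\<close> is the offset, in the value of the coordinate sum, between the middle of the third
    strip and the centre of the rectangle cut out by the other two.\<close>
  define d where "d = (z - x - y) - (x + y + a + b - 1 - z - c)"
  have area: "4 * int N + d\<^sup>2 \<le> 4 * a * b - (a + b - c)\<^sup>2 + 1"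
    using card_le_of_projections[OF ne fin x y z] N by (simp add: d_def)

  define k where "k = nat \<lceil>r\<rceil>"
  have k: "r \<le> k" "k \<le> r + 1"
    using r(1) by (auto simp: k_def)
  have "real N \<le> real (3 * k\<^sup>2)"
    using power_mono[OF k(1) r(1), of 2] r(2) by simp
  then have "N \<le> 3 * k\<^sup>2"
    by (simp only: of_nat_le_iff)
  then obtain T where T: "finite T" "card T = N" "perimeter T \<le> 6 * (2 * k + 1)"
    using exists_small_perimeter by blast
  have "card (bond_pairs T) \<le> card (bond_pairs S)"
    using S T N by (simp add: bond_maximal_def)
  then have "perimeter S \<le> 6 * (2 * k + 1)"
    using bonds_plus_perimeter[OF fin] bonds_plus_perimeter[OF T(1)] T N by linarith
  then have "card (fst ` S) + card (snd ` S) + card ((\<lambda>p. fst p + snd p) ` S) \<le> 3 * (2 * k + 1)"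
    using perimeter_ge_lines[OF fin] by simp
  then have "a + b + c \<le> 3 * (2 * int k + 1)"
    unfolding a_def b_def c_def by (simp flip: of_nat_add)
  then have "real_of_int (a + b + c) \<le> real_of_int (3 * (2 * int k + 1))"
    by (simp only: of_int_le_iff)
  then have p: "real_of_int a + b + c \<le> 6 * r + 9"
    using k(2) by simp

  have sq: "(real_of_int a + b + c)\<^sup>2 \<le> (6 * r + 9)\<^sup>2"
    using p by (intro power_mono) (auto simp: a_def b_def c_def)
  \<comment> \<open>With the perimeter \<open>a + b + c\<close> given, the area bound loses the defect \<open>D\<close> of the three widths
    from being equal; since the area is \<open>N\<close> and the perimeter is optimal up to a constant, both \<open>D\<close>
    and \<open>d\<^sup>2\<close> are of order \<open>r\<close>.\<close>
  define X where "X = 4 * real_of_int a * b - (real_of_int a + b - c)\<^sup>2"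
  define D where "D = (real_of_int a - b)\<^sup>2 + (real_of_int b - c)\<^sup>2 + (real_of_int a - c)\<^sup>2"
  have "real_of_int (4 * int N + d\<^sup>2) \<le> of_int (4 * a * b - (a + b - c)\<^sup>2 + 1)"
    using area by (simp only: of_int_le_iff)
  then have "4 * real N + (real_of_int d)\<^sup>2 \<le> X + 1"
    by (simp add: X_def)
  moreover have "3 * X + 2 * D = (real_of_int a + b + c)\<^sup>2"
    by (simp add: X_def D_def power2_eq_square algebra_simps)
  moreover have "(6 * r + 9)\<^sup>2 = 12 * real N + 108 * r + 81"
    using r(2) by (simp add: power2_eq_square algebra_simps)
  ultimately have "3 * (real_of_int d)\<^sup>2 + 2 * D \<le> 108 * r + 84"
    using sq by simp
  then have excess: "3 * (real_of_int d)\<^sup>2 + 2 * D \<le> 147 * q\<^sup>2"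
    using rq qq by linarith
  have D0: "D \<ge> 0" by (simp add: D_def)
  have "(real_of_int d)\<^sup>2 \<le> (7 * q)\<^sup>2"
    using excess D0 by (simp add: power_mult_distrib)
  then have d: "\<bar>real_of_int d\<bar> \<le> 7 * q"
    using q(1) abs_le_square_iff[of "real_of_int d" "7 * q"] by simp
  have square_sum_le: "(s + t)\<^sup>2 \<le> 2 * (s\<^sup>2 + t\<^sup>2)" for s t :: real
    using sum_squares_bound[of s t] by (simp add: power2_sum)
  have third: "t / 2 \<le> r + 3/2 + 25/12 * q"
    if "(t - t')\<^sup>2 + (t - t'')\<^sup>2 \<le> D" "t + t' + t'' \<le> 6 * r + 9" for t t' t'' :: real
  proof -
    have "((t - t') + (t - t''))\<^sup>2 \<le> 2 * ((t - t')\<^sup>2 + (t - t'')\<^sup>2)"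
      by (rule square_sum_le)
    also have "\<dots> \<le> 2 * D"
      using that(1) by simp
    also have "\<dots> \<le> 147 * q\<^sup>2"
      using excess zero_le_power2[of "real_of_int d"] by linarith
    also have "\<dots> \<le> (25/2 * q)\<^sup>2"
      by (simp add: power_mult_distrib power2_eq_square)
    finally have "\<bar>(t - t') + (t - t'')\<bar> \<le> 25/2 * q"
      using q(1) abs_le_square_iff[of "(t - t') + (t - t'')" "25/2 * q"] by simp
    then show ?thesis using that(2) by linarith
  qed
  have a: "real_of_int a / 2 \<le> r + 8 * q"
    using third[of a b c] p q(1) by (simp add: D_def)
  have b: "real_of_int b / 2 \<le> r + 8 * q"
    using third[of b a c] p q(1) by (simp add: D_def power2_commute)
  have c: "real_of_int c / 2 + \<bar>real_of_int d\<bar> / 2 \<le> r + 8 * q"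
    using third[of c a b] p q(1) d by (simp add: D_def power2_commute)

  define u v where "u = real_of_int x + real_of_int a / 2 - 1 / 2"
    and "v = real_of_int y + real_of_int b / 2 - 1 / 2"
  have "\<bar>of_int (fst p) - u\<bar> \<le> r + 8 * q \<and> \<bar>of_int (snd p) - v\<bar> \<le> r + 8 * q \<and>
    \<bar>of_int (fst p) - u + (of_int (snd p) - v)\<bar> \<le> r + 8 * q"
    if "p \<in> S" for p
  proof -
    have "fst p \<in> {x..<x + a}" "snd p \<in> {y..<y + b}" "fst p + snd p \<in> {z..<z + c}"
      using that unfolding x[symmetric] y[symmetric] z[symmetric] by (rule imageI)+
    then have "x \<le> fst p" "fst p \<le> x + a - 1" "y \<le> snd p" "snd p \<le> y + b - 1"
      "z \<le> fst p + snd p" "fst p + snd p \<le> z + c - 1"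
      by simp_all
    note mem = this[THEN of_int_le_iff[where 'a = real, THEN iffD2], unfolded of_int_add of_int_diff of_int_1]
    have d_eq: "real_of_int d = 2 * real_of_int z + real_of_int c - 2 * real_of_int x - 2 * real_of_int y
      - real_of_int a - real_of_int b + 1"
      by (simp add: d_def)
    have "real_of_int d \<le> \<bar>real_of_int d\<bar>" "- real_of_int d \<le> \<bar>real_of_int d\<bar>"
      by simp_all
    then show ?thesis
      using mem a b c d_eq unfolding abs_le_iff u_def v_def
      by (intro conjI; linarith)
  qed
  then show ?thesis
    unfolding near_hexagon_def r_def q_def by blast
qed

section \<open>Area of the limiting hexagon\<close>

definition lattice_map :: "real^2 \<Rightarrow> real^2" where
  "lattice_map c = c$1 *\<^sub>R e1 + c$2 *\<^sub>R e2"

definition coord_hexagon :: "real \<Rightarrow> (real^2) set" where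
  "coord_hexagon \<rho> = {c. \<bar>c$1\<bar> \<le> \<rho> \<and> \<bar>c$2\<bar> \<le> \<rho> \<and> \<bar>c$1 + c$2\<bar> \<le> \<rho>}"

definition scaled_hexagon :: "real \<Rightarrow> (real^2) set" where
  "scaled_hexagon t = lattice_map ` coord_hexagon (t / sqrt 3)"

lemma linear_lattice_map: "linear lattice_map"
  by (rule linearI) (simp_all add: lattice_map_def algebra_simps)

lemma lattice_map_nth:
  "lattice_map c $ 1 = c$1 + c$2 / 2" "lattice_map c $ 2 = c$2 * sqrt 3 / 2"
  by (simp_all add: lattice_map_def e1_def e2_def)

lemma norm_e: "norm e1 = 1" "norm e2 = 1"
  by (simp_all add: e1_def e2_def norm_vec_def L2_set_def sum_2 power_divide)

lemma norm_lattice_map_le: "norm (lattice_map c) \<le> \<bar>c$1\<bar> + \<bar>c$2\<bar>"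
  unfolding lattice_map_def by (rule norm_triangle_le) (simp add: norm_e)

lemma inj_lattice_map: "inj lattice_map"
proof (rule injI)
  fix c d assume "lattice_map c = lattice_map d"
  then have "lattice_map c $ 1 = lattice_map d $ 1" "lattice_map c $ 2 = lattice_map d $ 2"
    by simp_all
  then show "c = d"
    by (simp add: lattice_map_nth vec_eq_iff forall_2)
qed

lemma surj_lattice_map: "surj lattice_map"
  using linear_injective_imp_surjective[OF linear_lattice_map inj_lattice_map] by simp

lemma measure_lattice_map_image:
  assumes "S \<in> lmeasurable"
  shows "measure lebesgue (lattice_map ` S) = sqrt 3 / 2 * measure lebesgue S"
proof -
  have "\<bar>det (matrix lattice_map)\<bar> = sqrt 3 / 2"
    by (simp add: det_2 matrix_def lattice_map_nth axis_def)
  then show ?thesis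
    using measure_linear_image[OF linear_lattice_map assms] by metis
qed

lemma compact_coord_hexagon: "compact (coord_hexagon \<rho>)"
proof -
  have "closed (coord_hexagon \<rho>)"
    unfolding coord_hexagon_def
    by (intro closed_Collect_conj closed_Collect_le continuous_intros)
  moreover have "coord_hexagon \<rho> \<subseteq> cbox (vector [-\<rho>, -\<rho>]) (vector [\<rho>, \<rho>])"
    by (auto simp: coord_hexagon_def mem_box_cart forall_2 abs_le_iff)
  ultimately show ?thesis
    using bounded_subset[OF bounded_cbox] compact_eq_bounded_closed by blast
qed

lemma compact_scaled_hexagon: "compact (scaled_hexagon t)"
  unfolding scaled_hexagon_def
  by (intro compact_continuous_image linear_continuous_on linear_conv_bounded_linear[THEN iffD1]
      linear_lattice_map compact_coord_hexagon)

lemma scaled_hexagon_mono: "s \<le> t \<Longrightarrow> scaled_hexagon s \<subseteq> scaled_hexagon t"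
  unfolding scaled_hexagon_def coord_hexagon_def
  using divide_right_mono[of s t "sqrt 3"] by (intro image_mono) auto

lemma convex_combination_with_zero:
  assumes "convex H" "0 \<in> H" "v \<in> H" "w \<in> H" "0 \<le> s" "0 \<le> t" "s + t \<le> 1"
  shows "s *\<^sub>R v + t *\<^sub>R w \<in> H"
proof -
  have "(1 - t) *\<^sub>R (s / (1 - t)) *\<^sub>R v + t *\<^sub>R w \<in> H" if "t < 1"
  proof (rule convexD[OF assms(1)])
    have "(s / (1 - t)) *\<^sub>R v + (1 - s / (1 - t)) *\<^sub>R 0 \<in> H"
      using assms that by (intro convexD[OF assms(1)]) auto
    then show "(s / (1 - t)) *\<^sub>R v \<in> H" by simp
  qed (use assms that in auto)
  moreover have "s = 0 \<and> t = 1" if "\<not> t < 1"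
    using assms that by auto
  ultimately show ?thesis
    using assms(4) by (cases "t < 1") auto
qed

text \<open>For the nontrivial inclusion, the hexagon is divided into the six triangles spanned by the origin and
  two adjacent vertices; which of them contains a point is determined by the signs of its
  coordinates and of their sum.\<close>

lemma hexagon_eq_scaled_hexagon: "hexagon = scaled_hexagon 1"
proof
  let ?r = "1 / sqrt 3"
  have rhs: "convex (scaled_hexagon 1)"
  proof -
    have "coord_hexagon ?r = (\<lambda>c. c$1) -` {- ?r..?r} \<inter> ((\<lambda>c. c$2) -` {- ?r..?r} \<inter> (\<lambda>c. c$1 + c$2) -` {- ?r..?r})"
      by (auto simp: coord_hexagon_def abs_le_iff)
    then have "convex (coord_hexagon ?r)"
      by (auto intro!: convex_Int convex_linear_vimage linearI simp: algebra_simps)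
    then show ?thesis
      unfolding scaled_hexagon_def by (intro convex_linear_image linear_lattice_map) simp
  qed
  have vert: "a *\<^sub>R e1 + b *\<^sub>R e2 \<in> scaled_hexagon 1"
    if "\<bar>a\<bar> \<le> ?r" "\<bar>b\<bar> \<le> ?r" "\<bar>a + b\<bar> \<le> ?r" for a b
    unfolding scaled_hexagon_def
    by (rule image_eqI[of _ _ "vector [a, b]"]) (use that in \<open>auto simp: lattice_map_def coord_hexagon_def\<close>)
  show "hexagon \<subseteq> scaled_hexagon 1"
    unfolding hexagon_def
  proof (intro hull_minimal rhs)
    show "{?r *\<^sub>R e1, - ?r *\<^sub>R e1, ?r *\<^sub>R e2, - ?r *\<^sub>R e2, ?r *\<^sub>R (e2 - e1), - ?r *\<^sub>R (e2 - e1)}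
      \<subseteq> scaled_hexagon 1"
      using vert[of ?r 0] vert[of "- ?r" 0] vert[of 0 ?r] vert[of 0 "- ?r"] vert[of "- ?r" ?r] vert[of ?r "- ?r"]
      by (simp add: algebra_simps)
  qed
  have conv: "convex hexagon"
    by (simp add: hexagon_def)
  have v: "?r *\<^sub>R e1 \<in> hexagon" "- ?r *\<^sub>R e1 \<in> hexagon" "?r *\<^sub>R e2 \<in> hexagon"
    "- ?r *\<^sub>R e2 \<in> hexagon" "?r *\<^sub>R (e2 - e1) \<in> hexagon" "- ?r *\<^sub>R (e2 - e1) \<in> hexagon"
    unfolding hexagon_def by (rule hull_inc, simp)+
  have "(1/2) *\<^sub>R (?r *\<^sub>R e1) + (1/2) *\<^sub>R (- ?r *\<^sub>R e1) \<in> hexagon"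
    using conv v by (intro convexD) auto
  then have zero: "0 \<in> hexagon" by simp
  note comb = convex_combination_with_zero[OF conv zero]
  show "scaled_hexagon 1 \<subseteq> hexagon"
  proof
    fix w assume "w \<in> scaled_hexagon 1"
    then obtain c :: "real^2" where c: "w = c$1 *\<^sub>R e1 + c$2 *\<^sub>R e2" "\<bar>c$1\<bar> \<le> ?r" "\<bar>c$2\<bar> \<le> ?r" "\<bar>c$1 + c$2\<bar> \<le> ?r"
      by (auto simp: scaled_hexagon_def coord_hexagon_def lattice_map_def)
    define a b where "a = c$1 * sqrt 3" and "b = c$2 * sqrt 3"
    have ab: "\<bar>a\<bar> \<le> 1" "\<bar>b\<bar> \<le> 1" "\<bar>a + b\<bar> \<le> 1"
      using c(2-4) by (simp_all add: a_def b_def abs_mult pos_le_divide_eq flip: distrib_right)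
    have w: "w = (a * ?r) *\<^sub>R e1 + (b * ?r) *\<^sub>R e2"
      by (simp add: c(1) a_def b_def)
    consider "a \<ge> 0" "b \<ge> 0" | "a \<le> 0" "b \<le> 0" | "a \<ge> 0" "b \<le> 0" "a + b \<ge> 0" | "a \<ge> 0" "b \<le> 0" "a + b \<le> 0"
      | "a \<le> 0" "b \<ge> 0" "a + b \<ge> 0" | "a \<le> 0" "b \<ge> 0" "a + b \<le> 0"
      by linarith
    then show "w \<in> hexagon"
    proof cases
      case 1
      with comb[OF v(1,3), of a b] ab show ?thesis by (simp add: w)
    next
      case 2
      with comb[OF v(2,4), of "- a" "- b"] ab show ?thesis by (simp add: w)
    next
      case 3
      with comb[OF v(1,6), of "a + b" "- b"] ab show ?thesis by (simp add: w algebra_simps add_divide_distrib diff_divide_distrib)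
    next
      case 4
      with comb[OF v(6,4), of a "- (a + b)"] ab show ?thesis by (simp add: w algebra_simps add_divide_distrib diff_divide_distrib)
    next
      case 5
      with comb[OF v(5,3), of "- a" "a + b"] ab show ?thesis by (simp add: w algebra_simps add_divide_distrib diff_divide_distrib)
    next
      case 6
      with comb[OF v(2,5), of "- (a + b)" b] ab show ?thesis by (simp add: w algebra_simps add_divide_distrib diff_divide_distrib)
    qed
  qed
qed

lemma measure_scaled_hexagon:
  assumes "t > 0"
  shows "measure lborel (scaled_hexagon t) = t\<^sup>2 * measure lborel hexagon"
proof -
  have "scaled_hexagon t = (*\<^sub>R) t ` scaled_hexagon 1"
  proof -
    have "coord_hexagon (t / sqrt 3) = (*\<^sub>R) t ` coord_hexagon (1 / sqrt 3)"
    proof -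
      have iff: "t *\<^sub>R c \<in> coord_hexagon (t / sqrt 3) \<longleftrightarrow> c \<in> coord_hexagon (1 / sqrt 3)" for c
        using assms mult_le_cancel_left_pos[of t _ "1 / sqrt 3"]
        by (simp add: coord_hexagon_def abs_mult flip: distrib_left)
      have "c \<in> (*\<^sub>R) t ` coord_hexagon (1 / sqrt 3)" if "c \<in> coord_hexagon (t / sqrt 3)" for c
        using iff[of "(1 / t) *\<^sub>R c"] that assms by (intro image_eqI[of _ _ "(1 / t) *\<^sub>R c"]) auto
      then show ?thesis
        using iff by blast
    qed
    then show ?thesis
      by (simp add: scaled_hexagon_def image_image linear_cmul[OF linear_lattice_map])
  qed
  then have "measure lebesgue (scaled_hexagon t) = t\<^sup>2 * measure lebesgue (scaled_hexagon 1)"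
    using measure_lebesgue_affine[of t 0 "scaled_hexagon 1"] assms by simp
  moreover have "scaled_hexagon s \<in> sets lborel" for s
    using borel_compact[OF compact_scaled_hexagon] by simp
  ultimately show ?thesis
    by (simp add: hexagon_eq_scaled_hexagon)
qed

text \<open>The hexagon is covered by three rhombi that have its centre as a common vertex, each the image of the
  square of side \<open>r\<close> under a unimodular map.\<close>

lemma measure_coord_hexagon_le:
  assumes "r \<ge> 0"
  shows "measure lebesgue (coord_hexagon r) \<le> 3 * r\<^sup>2"
proof -
  define sq where "sq = cbox (0::real^2) (vector [r, r])"
  define f1 f2 f3 :: "real^2 \<Rightarrow> real^2" where "f1 = (\<lambda>c. vector [c$1 - c$2, c$2])"
    and "f2 = (\<lambda>c. vector [- c$1, c$1 - c$2])" and "f3 = (\<lambda>c. vector [c$2, - c$1])"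
  have lin: "linear f1" "linear f2" "linear f3"
    by (rule linearI; simp add: f1_def f2_def f3_def vec_eq_iff forall_2 algebra_simps)+
  have det: "\<bar>det (matrix f1)\<bar> = 1" "\<bar>det (matrix f2)\<bar> = 1" "\<bar>det (matrix f3)\<bar> = 1"
    by (simp_all add: det_2 matrix_def axis_def f1_def f2_def f3_def)
  have sq: "sq \<in> lmeasurable" "measure lebesgue sq = r\<^sup>2"
  proof -
    have "sq \<noteq> {}"
      using assms by (simp add: sq_def interval_ne_empty_cart forall_2)
    then show "measure lebesgue sq = r\<^sup>2"
      by (simp add: sq_def content_cbox_cart UNIV_2 power2_eq_square)
  qed (simp add: sq_def)
  have img: "f ` sq \<in> lmeasurable" "measure lebesgue (f ` sq) = r\<^sup>2"
    if "linear f" "\<bar>det (matrix f)\<bar> = 1" for f :: "real^2 \<Rightarrow> real^2"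
    using measurable_linear_image[OF that(1) sq(1)] measure_linear_image[OF that(1) sq(1)] that(2) sq(2) by auto
  have "coord_hexagon r \<subseteq> f1 ` sq \<union> f2 ` sq \<union> f3 ` sq"
  proof
    fix c assume c: "c \<in> coord_hexagon r"
    consider "c$2 \<ge> 0" "c$1 + c$2 \<ge> 0" | "c$1 \<le> 0" "c$1 + c$2 \<le> 0" | "c$1 \<ge> 0" "c$2 \<le> 0"
      by linarith
    then show "c \<in> f1 ` sq \<union> f2 ` sq \<union> f3 ` sq"
    proof cases
      case 1
      then have "c \<in> f1 ` sq"
        using c by (intro image_eqI[of _ _ "vector [c$1 + c$2, c$2]"])
          (auto simp: f1_def sq_def mem_box_cart forall_2 vec_eq_iff coord_hexagon_def)
      then show ?thesis by blast
    next
      case 2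
      then have "c \<in> f2 ` sq"
        using c by (intro image_eqI[of _ _ "vector [- c$1, - c$1 - c$2]"])
          (auto simp: f2_def sq_def mem_box_cart forall_2 vec_eq_iff coord_hexagon_def)
      then show ?thesis by blast
    next
      case 3
      then have "c \<in> f3 ` sq"
        using c by (intro image_eqI[of _ _ "vector [- c$2, c$1]"])
          (auto simp: f3_def sq_def mem_box_cart forall_2 vec_eq_iff coord_hexagon_def)
      then show ?thesis by blast
    qed
  qed
  then have "measure lebesgue (coord_hexagon r) \<le> measure lebesgue (f1 ` sq \<union> f2 ` sq \<union> f3 ` sq)"
    using img(1)[OF lin(1) det(1)] img(1)[OF lin(2) det(2)] img(1)[OF lin(3) det(3)]
    by (intro measure_mono_fmeasurable fmeasurable.Un fmeasurableD[OF lmeasurable_compact[OF compact_coord_hexagon]])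
  also have "\<dots> \<le> measure lebesgue (f1 ` sq \<union> f2 ` sq) + measure lebesgue (f3 ` sq)"
    using img lin det by (intro measure_Un_le) (auto intro!: fmeasurableD)
  also have "\<dots> \<le> measure lebesgue (f1 ` sq) + measure lebesgue (f2 ` sq) + measure lebesgue (f3 ` sq)"
    using img lin det by (intro add_right_mono measure_Un_le) (auto intro!: fmeasurableD)
  finally show ?thesis
    using img lin det by simp
qed

lemma measure_hexagon_le: "2 / sqrt 3 * measure lborel hexagon \<le> 1"
proof -
  have "measure lborel hexagon = measure lebesgue hexagon"
    using borel_compact[OF compact_scaled_hexagon] by (simp add: hexagon_eq_scaled_hexagon)
  also have "\<dots> = sqrt 3 / 2 * measure lebesgue (coord_hexagon (1 / sqrt 3))"
    unfolding hexagon_eq_scaled_hexagon scaled_hexagon_def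
    by (intro measure_lattice_map_image lmeasurable_compact compact_coord_hexagon)
  also have "\<dots> \<le> sqrt 3 / 2 * (3 * (1 / sqrt 3)\<^sup>2)"
    by (intro mult_left_mono measure_coord_hexagon_le) auto
  finally show ?thesis
    by (simp add: power_divide field_simps)
qed

section \<open>Averages over sites and integrals over cells\<close>

lemma integral_hexagon_measure:
  fixes f :: "real^2 \<Rightarrow> real"
  assumes "continuous_on UNIV f"
  shows "integral\<^sup>L hexagon_measure f = 2 / sqrt 3 * (LINT w|lborel. indicator hexagon w * f w)"
proof -
  have "hexagon \<in> sets borel"
    using borel_compact[OF compact_scaled_hexagon] by (simp add: hexagon_eq_scaled_hexagon)
  then have "integral\<^sup>L hexagon_measure f = (LINT w|lborel. (2 / sqrt 3 * indicator hexagon w) *\<^sub>R f w)"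
    unfolding hexagon_measure_def
    using assms by (intro integral_density) (auto intro: borel_measurable_continuous_onI)
  then show ?thesis
    by (simp add: mult.assoc)
qed

lemma finite_hexagon_measure: "hexagon_measure \<in> finite_radon_measures"
proof -
  have "compact hexagon"
    by (simp add: hexagon_eq_scaled_hexagon compact_scaled_hexagon)
  then have hex: "hexagon \<in> sets lborel" "emeasure lborel hexagon < \<infinity>"
    using emeasure_compact_finite by (auto intro: borel_compact)
  have "emeasure hexagon_measure UNIV = (\<integral>\<^sup>+z. ennreal (2 / sqrt 3) * indicator hexagon z \<partial>lborel)"
    unfolding hexagon_measure_def using hex(1)
    by (subst emeasure_density) (auto intro!: nn_integral_cong simp: indicator_def)
  also have "\<dots> = ennreal (2 / sqrt 3) * emeasure lborel hexagon"
    using hex(1) by (rule nn_integral_cmult_indicator)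
  also have "\<dots> < \<infinity>"
    using hex(2) by (simp add: ennreal_mult_less_top)
  finally have "emeasure hexagon_measure UNIV \<noteq> \<infinity>"
    by simp
  then have "finite_measure hexagon_measure"
    by (intro finite_measureI) (simp add: hexagon_measure_def)
  then show ?thesis
    by (simp add: finite_radon_measures_def hexagon_measure_def)
qed

text \<open>Lattice coordinates of a site, relative to the centre \<open>(u, v)\<close> and scaled down by \<open>s\<close>.\<close>

definition rescaled_site :: "real \<Rightarrow> real \<Rightarrow> real \<Rightarrow> int \<times> int \<Rightarrow> real^2" where
  "rescaled_site s u v p = vector [(of_int (fst p) - u) / s, (of_int (snd p) - v) / s]"

text \<open>The open rescaled unit cell with the given site at its lower left corner. Cells are open so that
  different cells are disjoint.\<close>

definition cell :: "real \<Rightarrow> real \<Rightarrow> real \<Rightarrow> int \<times> int \<Rightarrow> (real^2) set" where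
  "cell s u v p = lattice_map ` box (rescaled_site s u v p) (rescaled_site s u v p + vector [1 / s, 1 / s])"

lemma mem_cell_box:
  assumes "c \<in> box (rescaled_site s u v p) (rescaled_site s u v p + vector [1 / s, 1 / s])" and "s > 0"
  shows "of_int (fst p) < s * c$1 + u" "s * c$1 + u < of_int (fst p) + 1"
    "of_int (snd p) < s * c$2 + v" "s * c$2 + v < of_int (snd p) + 1"
  using assms by (auto simp: mem_box_cart forall_2 rescaled_site_def field_simps)

lemma open_cell: "open (cell s u v p)"
  unfolding cell_def
  using open_surjective_linear_image[OF open_box linear_lattice_map surj_lattice_map] .

lemma measure_cell:
  assumes "s > 0"
  shows "measure lborel (cell s u v p) = sqrt 3 / 2 / s\<^sup>2"
proof -
  let ?l = "rescaled_site s u v p" and ?d = "vector [1 / s, 1 / s] :: real^2"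
  have "cbox ?l (?l + ?d) \<noteq> {}"
    using assms by (simp add: interval_ne_empty_cart forall_2)
  then have "measure lebesgue (box ?l (?l + ?d)) = 1 / s\<^sup>2"
    using content_cbox_cart[of ?l "?l + ?d"]
    by (simp add: UNIV_2 power2_eq_square measure_lborel_box_eq measure_lborel_cbox_eq)
  moreover have "measure lborel (cell s u v p) = measure lebesgue (cell s u v p)"
    using open_cell by simp
  ultimately show ?thesis
    using measure_lattice_map_image[of "box ?l (?l + ?d)"] by (simp add: cell_def)
qed

lemma cell_dist:
  assumes "w \<in> cell s u v p" "s > 0"
  shows "dist (lattice_map (rescaled_site s u v p)) w \<le> 2 / s"
proof -
  let ?l = "rescaled_site s u v p"
  obtain c where c: "w = lattice_map c" "c \<in> box ?l (?l + vector [1 / s, 1 / s])"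
    using assms(1) by (auto simp: cell_def)
  have "dist (lattice_map ?l) w = norm (lattice_map (c - ?l))"
    by (simp add: c(1) dist_norm norm_minus_commute linear_diff[OF linear_lattice_map])
  also have "\<dots> \<le> \<bar>(c - ?l)$1\<bar> + \<bar>(c - ?l)$2\<bar>"
    by (rule norm_lattice_map_le)
  also have "\<dots> \<le> 2 / s"
    using c(2) by (auto simp: mem_box_cart forall_2)
  finally show ?thesis .
qed

lemma cell_unique:
  assumes "w \<in> cell s u v p" "w \<in> cell s u v q" "s > 0"
  shows "p = q"
proof -
  obtain c where c: "w = lattice_map c" "c \<in> box (rescaled_site s u v p) (rescaled_site s u v p + vector [1 / s, 1 / s])"
    using assms(1) by (auto simp: cell_def)
  obtain d where d: "w = lattice_map d" "d \<in> box (rescaled_site s u v q) (rescaled_site s u v q + vector [1 / s, 1 / s])"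
    using assms(2) unfolding cell_def by blast
  have "c = d"
    using c(1) d(1) inj_lattice_map by (auto dest: injD)
  then show ?thesis
    using mem_cell_box[OF c(2) assms(3)] mem_cell_box[OF d(2) assms(3)] by (auto simp: prod_eq_iff)
qed

lemma cell_subset_scaled_hexagon:
  assumes near: "near_hexagon \<rho> u v S" "p \<in> S" and s: "s > 0" and t: "(\<rho> + 2) / s \<le> t / sqrt 3"
  shows "cell s u v p \<subseteq> scaled_hexagon t"
proof -
  have "c \<in> coord_hexagon (t / sqrt 3)"
    if c: "c \<in> box (rescaled_site s u v p) (rescaled_site s u v p + vector [1 / s, 1 / s])" for c
  proof -
    have le: "\<bar>x\<bar> \<le> t / sqrt 3" if "\<bar>s * x\<bar> \<le> \<rho> + 2" for x
    proof -
      have "\<bar>x\<bar> \<le> (\<rho> + 2) / s"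
        using that s by (simp add: abs_mult pos_le_divide_eq mult.commute)
      with t show ?thesis by simp
    qed
    \<comment> \<open>A cell extends by less than 1 in each of the first two coordinates, hence by less than 2 in
      their sum.\<close>
    have "\<bar>s * c$1\<bar> \<le> \<rho> + 2" "\<bar>s * c$2\<bar> \<le> \<rho> + 2" "\<bar>s * (c$1 + c$2)\<bar> \<le> \<rho> + 2"
      using bspec[OF near(1)[unfolded near_hexagon_def] near(2)] mem_cell_box[OF c s]
      unfolding distrib_left by linarith+
    then show ?thesis
      unfolding coord_hexagon_def using le by blast
  qed
  then show ?thesis
    unfolding cell_def scaled_hexagon_def by blast
qed

text \<open>The value of \<open>f\<close> at a site is compared with its mean over the cell of the site. As the cells are
  disjoint and contained in a slightly enlarged hexagon, and as \<open>f\<close> is nonnegative, the sum over the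
  sites is at most the integral over the enlarged hexagon, up to the oscillation \<open>\<eta>\<close> of \<open>f\<close>; the
  collar between the two hexagons costs \<open>M (t\<^sup>2 - 1)\<close>.\<close>

lemma site_average_le:
  fixes f :: "real^2 \<Rightarrow> real"
  assumes f: "continuous_on UNIV f" and f0: "\<And>w. w \<in> scaled_hexagon 2 \<Longrightarrow> 0 \<le> f w"
    and fM: "\<And>w. w \<in> scaled_hexagon 2 \<Longrightarrow> f w \<le> M"
    and S: "finite S" and s: "s > 0" and t: "1 \<le> t" "t \<le> 2" and \<eta>: "0 \<le> \<eta>"
    and cells: "\<And>p. p \<in> S \<Longrightarrow> cell s u v p \<subseteq> scaled_hexagon t"
    and osc: "\<And>p w. p \<in> S \<Longrightarrow> w \<in> cell s u v p \<Longrightarrow> f (lattice_map (rescaled_site s u v p)) \<le> f w + \<eta>"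
  shows "(\<Sum>p\<in>S. f (lattice_map (rescaled_site s u v p))) / s\<^sup>2
    \<le> integral\<^sup>L hexagon_measure f + M * (t\<^sup>2 - 1) + \<eta> * t\<^sup>2"
proof -
  let ?z = "\<lambda>p. f (lattice_map (rescaled_site s u v p))"
  let ?K = "scaled_hexagon t" and ?A = "measure lborel hexagon"
  have hexK: "hexagon \<subseteq> ?K" and K2: "?K \<subseteq> scaled_hexagon 2"
    using scaled_hexagon_mono t by (auto simp: hexagon_eq_scaled_hexagon)
  have hex2: "hexagon \<subseteq> scaled_hexagon 2"
    using hexK K2 by blast
  have comp: "compact hexagon" "compact ?K"
    by (simp_all add: hexagon_eq_scaled_hexagon compact_scaled_hexagon)
  have int_cell: "integrable lborel (indicator (cell s u v p) :: real^2 \<Rightarrow> real)" if "p \<in> S" for p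
  proof -
    have "bounded (cell s u v p)"
      using cells[OF that] comp(2) by (meson bounded_subset compact_imp_bounded)
    then have "emeasure lborel (cell s u v p) < \<infinity>"
      by (rule emeasure_bounded_finite)
    then show ?thesis
      using open_cell by (intro integrable_real_indicator) auto
  qed
  have int_hex: "integrable lborel (indicator hexagon :: real^2 \<Rightarrow> real)"
    and int_K: "integrable lborel (indicator ?K :: real^2 \<Rightarrow> real)"
    using comp emeasure_compact_finite by (auto intro!: integrable_real_indicator borel_compact)
  have int_f: "integrable lborel (\<lambda>w. indicator hexagon w * f w)"
    using borel_integrable_compact[OF comp(1) continuous_on_subset[OF f subset_UNIV]] by simp
  have pointwise: "(\<Sum>p\<in>S. ?z p * indicator (cell s u v p) w)
      \<le> indicator hexagon w * f w + M * (indicator ?K w - indicator hexagon w) + \<eta> * indicator ?K w" for w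
  proof -
    have "(\<Sum>p\<in>S. ?z p * indicator (cell s u v p) w) \<le> indicator ?K w * (f w + \<eta>)"
    proof (cases "\<exists>p\<in>S. w \<in> cell s u v p")
      case True
      then obtain p where p: "p \<in> S" "w \<in> cell s u v p" by blast
      have "?z q * indicator (cell s u v q) w = 0" if "q \<in> S - {p}" for q
        using that cell_unique[OF _ p(2) s, of q] by (auto simp: indicator_def)
      then have "(\<Sum>q\<in>S. ?z q * indicator (cell s u v q) w) = (\<Sum>q\<in>{p}. ?z q * indicator (cell s u v q) w)"
        using S p(1) by (intro sum.mono_neutral_right) blast+
      then show ?thesis
        using p osc[OF p] subsetD[OF cells[OF p(1)] p(2)] by simp
    next
      case False
      then have "(\<Sum>p\<in>S. ?z p * indicator (cell s u v p) w) = 0"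
        by (intro sum.neutral) auto
      then show ?thesis
        using f0[of w] K2 \<eta> by (auto simp: indicator_def)
    qed
    also have "\<dots> \<le> indicator hexagon w * f w + M * (indicator ?K w - indicator hexagon w) + \<eta> * indicator ?K w"
      using hexK K2 fM[of w] by (auto simp: indicator_def)
    finally show ?thesis .
  qed
  have "(\<Sum>p\<in>S. ?z p * (sqrt 3 / 2 / s\<^sup>2)) = (\<Sum>p\<in>S. LINT w|lborel. ?z p * indicator (cell s u v p) w)"
    using measure_cell[OF s] by simp
  also have "\<dots> = (LINT w|lborel. (\<Sum>p\<in>S. ?z p * indicator (cell s u v p) w))"
    using int_cell by (intro Bochner_Integration.integral_sum[symmetric]) auto
  also have "\<dots> \<le> (LINT w|lborel. indicator hexagon w * f w + M * (indicator ?K w - indicator hexagon w) + \<eta> * indicator ?K w)"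
    using int_cell int_f int_hex int_K pointwise by (intro integral_mono) auto
  also have "\<dots> = (LINT w|lborel. indicator hexagon w * f w) + M * (measure lborel ?K - ?A) + \<eta> * measure lborel ?K"
    using int_f int_hex int_K by simp
  also have "\<dots> = (LINT w|lborel. indicator hexagon w * f w) + (M * (t\<^sup>2 - 1) + \<eta> * t\<^sup>2) * ?A"
    using measure_scaled_hexagon[of t] t by (simp add: algebra_simps)
  finally have "2 / sqrt 3 * (\<Sum>p\<in>S. ?z p * (sqrt 3 / 2 / s\<^sup>2))
      \<le> 2 / sqrt 3 * ((LINT w|lborel. indicator hexagon w * f w) + (M * (t\<^sup>2 - 1) + \<eta> * t\<^sup>2) * ?A)"
    by (intro mult_left_mono) auto
  also have "\<dots> = integral\<^sup>L hexagon_measure f + (M * (t\<^sup>2 - 1) + \<eta> * t\<^sup>2) * (2 / sqrt 3 * ?A)"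
    unfolding integral_hexagon_measure[OF f] by (simp add: algebra_simps)
  also have "\<dots> \<le> integral\<^sup>L hexagon_measure f + (M * (t\<^sup>2 - 1) + \<eta> * t\<^sup>2) * 1"
  proof (intro add_left_mono mult_left_mono measure_hexagon_le)
    have "0 \<in> scaled_hexagon 2"
      unfolding scaled_hexagon_def
      by (rule image_eqI[of _ _ 0]) (auto simp: coord_hexagon_def lattice_map_def)
    then have "0 \<le> M"
      using f0 fM order_trans by blast
    then show "0 \<le> M * (t\<^sup>2 - 1) + \<eta> * t\<^sup>2"
      using t \<eta> by (auto intro!: add_nonneg_nonneg mult_nonneg_nonneg simp: one_le_power)
  qed
  also have "2 / sqrt 3 * (\<Sum>p\<in>S. ?z p * (sqrt 3 / 2 / s\<^sup>2)) = (\<Sum>p\<in>S. ?z p) / s\<^sup>2"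
    by (simp add: sum_distrib_left sum_divide_distrib)
  finally show ?thesis by simp
qed

section \<open>Bond counting for minimizers of the energy\<close>

definition lattice_point :: "int \<times> int \<Rightarrow> real^2" where
  "lattice_point p = of_int (fst p) *\<^sub>R e1 + of_int (snd p) *\<^sub>R e2"

lemma triangular_lattice_eq: "triangular_lattice = range lattice_point"
  by (auto simp: triangular_lattice_def lattice_point_def image_def)

lemma lattice_point_diff: "lattice_point (p - q) = lattice_point p - lattice_point q"
  by (simp add: lattice_point_def algebra_simps)

lemma norm_lattice_point:
  "(norm (lattice_point p))\<^sup>2 = of_int ((fst p)\<^sup>2 + fst p * snd p + (snd p)\<^sup>2)"
proof -
  have "lattice_point p $ 1 = of_int (fst p) + of_int (snd p) / 2"
    "lattice_point p $ 2 = of_int (snd p) * sqrt 3 / 2"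
    by (simp_all add: lattice_point_def e1_def e2_def)
  then have "(norm (lattice_point p))\<^sup>2 =
      (of_int (fst p) + of_int (snd p) / 2)\<^sup>2 + (of_int (snd p) * sqrt 3 / 2)\<^sup>2"
    by (simp only: norm_vec_def L2_set_def sum_2 real_norm_def power2_abs)
      (simp only: real_sqrt_pow2 sum_power2_ge_zero)
  then show ?thesis
    by (simp add: power_mult_distrib power_divide power2_eq_square field_simps)
qed

text \<open>Completing the square shows that the quadratic form controls both coordinates. It does not take the
  value 2, so the vectors following the six unit vectors have length \<open>sqrt 3\<close>.\<close>

lemma short_lattice_vectors:
  fixes m n :: int
  assumes "m\<^sup>2 + m * n + n\<^sup>2 < 3"
  shows "(m, n) = 0 \<or> (m, n) \<in> hex_dirs"
proof -
  have small: "\<bar>l\<bar> \<le> 1" if "l\<^sup>2 < 4" for l :: int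
    using that power_mono[of 2 "\<bar>l\<bar>" 2] by (cases "\<bar>l\<bar> \<le> 1") auto
  define Q where "Q = m\<^sup>2 + m * n + n\<^sup>2"
  have "4 * Q = (2 * m + n)\<^sup>2 + 3 * n\<^sup>2" "4 * Q = (2 * n + m)\<^sup>2 + 3 * m\<^sup>2"
    by (simp_all add: Q_def power2_eq_square algebra_simps)
  moreover have "0 \<le> (2 * m + n)\<^sup>2" "0 \<le> (2 * n + m)\<^sup>2" "Q < 3"
    using assms by (simp_all add: Q_def)
  ultimately have "m\<^sup>2 < 4" "n\<^sup>2 < 4"
    by linarith+
  then have "m \<in> {-1, 0, 1}" "n \<in> {-1, 0, 1}"
    using small[of m] small[of n] by auto
  then show ?thesis
    using assms by (auto simp: hex_dirs_def zero_prod_def)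
qed

lemma norm_hex_dirs: "p \<in> hex_dirs \<Longrightarrow> norm (lattice_point p) = 1"
  using norm_lattice_point[of p] norm_ge_zero[of "lattice_point p"]
  by (auto simp: hex_dirs_def power2_eq_1_iff simp del: norm_ge_zero)

lemma norm_ge_sqrt3:
  assumes "p \<noteq> 0" "p \<notin> hex_dirs"
  shows "sqrt 3 \<le> norm (lattice_point p)"
proof -
  have "\<not> (fst p)\<^sup>2 + fst p * snd p + (snd p)\<^sup>2 < 3"
    using short_lattice_vectors[of "fst p" "snd p"] assms by auto
  then have "(3::real) \<le> of_int ((fst p)\<^sup>2 + fst p * snd p + (snd p)\<^sup>2)"
    by linarith
  then have "3 \<le> (norm (lattice_point p))\<^sup>2"
    by (simp only: norm_lattice_point)
  then show ?thesis
    by (rule real_le_lsqrt[rotated]) simp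
qed

lemma norm_lattice_point_ge_1:
  assumes "p \<noteq> 0"
  shows "1 \<le> norm (lattice_point p)"
proof (cases "p \<in> hex_dirs")
  case False
  have "1 \<le> sqrt 3" by simp
  also have "\<dots> \<le> norm (lattice_point p)"
    using assms False by (rule norm_ge_sqrt3)
  finally show ?thesis .
qed (simp add: norm_hex_dirs)

lemma inj_lattice_point: "inj lattice_point"
proof (rule injI)
  fix p q assume "lattice_point p = lattice_point q"
  then have "norm (lattice_point (p - q)) = 0"
    by (simp add: lattice_point_diff)
  then show "p = q"
    using norm_lattice_point_ge_1[of "p - q"] by auto
qed

text \<open>Otherwise the six unit vectors and \<open>e1 + e2\<close>, of length \<open>sqrt 3\<close>, would be seven points in the ball.\<close>

lemma range_less_sqrt3:
  assumes six: "at_most_six_neighbours \<alpha> \<beta>" and "\<alpha> \<le> 1"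
  shows "\<beta> < sqrt 3"
proof (rule ccontr)
  assume "\<not> \<beta> < sqrt 3"
  then have \<beta>: "sqrt 3 \<le> \<beta>" by simp
  let ?P = "insert (1, 1) hex_dirs"
  let ?S = "lattice_point ` ?P"
  have "(norm (lattice_point (1, 1)))\<^sup>2 = 3"
    by (simp add: norm_lattice_point)
  then have "norm (lattice_point (1, 1)) = sqrt 3"
    by (metis norm_ge_zero real_sqrt_unique)
  then have "norm z = 1 \<or> norm z = sqrt 3" if "z \<in> ?S" for z
    using that norm_hex_dirs by blast
  moreover have "1 \<le> sqrt 3"
    by simp
  ultimately have "norm z \<le> \<beta> \<and> \<alpha> \<le> norm z" if "z \<in> ?S" for z
    using that \<beta> \<open>\<alpha> \<le> 1\<close> by (metis order_trans)
  moreover have "\<alpha> \<le> dist z w" if zw: "z \<in> ?S" "w \<in> ?S" "z \<noteq> w" for z w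
  proof -
    obtain p q where pq: "z = lattice_point p" "w = lattice_point q"
      using zw(1,2) by blast
    then have "1 \<le> norm (lattice_point (p - q))"
      using zw(3) by (intro norm_lattice_point_ge_1) auto
    then show ?thesis
      using \<open>\<alpha> \<le> 1\<close> by (simp add: pq dist_norm lattice_point_diff)
  qed
  ultimately have "card ?S \<le> 6"
    using six unfolding at_most_six_neighbours_def by (simp add: subset_iff)
  moreover have "card ?S = card ?P"
    using inj_lattice_point by (intro card_image) (auto dest: injD intro: inj_onI)
  moreover have "card ?P = 7"
    by (simp add: hex_dirs_def)
  ultimately show False by simp
qed

lemma energy_cong:
  assumes "\<And>i j. i < N \<Longrightarrow> j < N \<Longrightarrow> norm (x i - x j) = norm (y i - y j)"
  shows "energy V N x = energy V N y"
  unfolding energy_def using assms by (intro sum.cong) auto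

text \<open>Different lattice points have distance 1, where the potential is \<open>-1\<close>, or at least \<open>sqrt 3\<close>, which is
  beyond its range.\<close>

lemma energy_lattice_configuration:
  assumes V: "normalized_well V" "hard_core_finite_range \<alpha> \<beta> V" "at_most_six_neighbours \<alpha> \<beta>"
    and c: "inj_on c {..<N}"
  shows "energy V N (\<lambda>i. lattice_point (c i)) = ereal (- real (card (bond_pairs (c ` {..<N}))))"
proof -
  let ?P = "{(i, j). i < N \<and> j < N \<and> i \<noteq> j}"
  have fin: "finite ?P"
    by (rule finite_subset[of _ "{..<N} \<times> {..<N}"]) auto
  have \<beta>: "\<beta> < sqrt 3" and V1: "V 1 = -1" and V0: "\<And>r. r > \<beta> \<Longrightarrow> V r = 0"
    using V range_less_sqrt3 by (auto simp: normalized_well_def hard_core_finite_range_def)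
  have "energy V N (\<lambda>i. lattice_point (c i)) =
      (\<Sum>(i, j)\<in>?P. ereal (if c j - c i \<in> hex_dirs then -1 else 0))"
    unfolding energy_def
  proof (rule sum.cong[OF refl], clarify)
    fix i j assume ij: "i < N" "j < N" "i \<noteq> j"
    have nrm: "norm (lattice_point (c i) - lattice_point (c j)) = norm (lattice_point (c j - c i))"
      by (simp add: lattice_point_diff norm_minus_commute)
    have "c j - c i \<noteq> 0"
      using c ij by (auto dest: inj_onD)
    then have "\<beta> < norm (lattice_point (c j - c i))" if "c j - c i \<notin> hex_dirs"
      using norm_ge_sqrt3 that \<beta> by fastforce
    then show "V (norm (lattice_point (c i) - lattice_point (c j))) =
        ereal (if c j - c i \<in> hex_dirs then -1 else 0)"
      unfolding nrm using norm_hex_dirs V0 V1 by (auto simp: one_ereal_def)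
  qed
  also have "\<dots> = ereal (\<Sum>(i, j)\<in>?P. if c j - c i \<in> hex_dirs then -1 else 0)"
    by (simp add: case_prod_unfold)
  also have "(\<Sum>(i, j)\<in>?P. if c j - c i \<in> hex_dirs then -1 else 0) =
      - real (card {p\<in>?P. c (snd p) - c (fst p) \<in> hex_dirs})"
    using fin by (simp add: case_prod_unfold sum.If_cases Int_def)
  also have "card {p\<in>?P. c (snd p) - c (fst p) \<in> hex_dirs} = card (bond_pairs (c ` {..<N}))"
  proof -
    let ?Q = "{p\<in>?P. c (snd p) - c (fst p) \<in> hex_dirs}"
    have "0 \<notin> hex_dirs"
      by (simp add: hex_dirs_def zero_prod_def)
    have "(p, q) \<in> map_prod c c ` ?Q" if pq: "(p, q) \<in> bond_pairs (c ` {..<N})" for p q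
    proof -
      obtain i j where ij: "i < N" "j < N" "p = c i" "q = c j" "c j - c i \<in> hex_dirs"
        using pq unfolding bond_pairs_def by blast
      then have "i \<noteq> j"
        using \<open>0 \<notin> hex_dirs\<close> by auto
      with ij show ?thesis
        by (intro image_eqI[of _ _ "(i, j)"]) auto
    qed
    then have "bond_pairs (c ` {..<N}) \<subseteq> map_prod c c ` ?Q"
      by (rule subrelI)
    moreover have "map_prod c c ` ?Q \<subseteq> bond_pairs (c ` {..<N})"
      unfolding bond_pairs_def by auto
    ultimately have "bond_pairs (c ` {..<N}) = map_prod c c ` ?Q" ..
    moreover have "inj_on (map_prod c c) ?Q"
      using c by (auto simp: inj_on_def)
    ultimately show ?thesis
      by (simp add: card_image)
  qed
  finally show ?thesis .
qed

lemma energy_coincident: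
  assumes "hard_core_finite_range \<alpha> \<beta> V" and "i < N" "j < N" "i \<noteq> j" "x i = x j"
  shows "energy V N x = \<infinity>"
proof -
  have "finite {(i, j). i < N \<and> j < N \<and> i \<noteq> j}"
    by (rule finite_subset[of _ "{..<N} \<times> {..<N}"]) auto
  moreover have "V (norm (x i - x j)) = \<infinity>"
    using assms by (simp add: hard_core_finite_range_def)
  ultimately show ?thesis
    unfolding energy_def sum_Pinfty using assms(2-4) by (auto intro!: bexI[of _ "(i, j)"])
qed

text \<open>Crystallization moves the minimizer into the lattice, where the energy counts bonds. Since every
  finite lattice set is itself an admissible configuration, no set of the same cardinality can have
  more bonds.\<close>

lemma minimizer_bond_maximal:
  assumes V: "normalized_well V" "hard_core_finite_range \<alpha> \<beta> V" "at_most_six_neighbours \<alpha> \<beta>"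
    and cryst: "crystallized_ground_states V N" and min: "minimizer V N x"
  shows "\<exists>R a c. rotation_matrix R \<and> (\<forall>i<N. R *v x i + a = lattice_point (c i)) \<and>
    inj_on c {..<N} \<and> bond_maximal (c ` {..<N})"
proof -
  have le: "energy V N x \<le> energy V N y" for y
    using min by (simp add: minimizer_def INF_lower)
  obtain R a where R: "rotation_matrix R" and sub: "(\<lambda>p. R *v p + a) ` x ` {..<N} \<subseteq> triangular_lattice"
    using cryst min by (auto simp: crystallized_ground_states_def)
  have "\<forall>i<N. \<exists>p. R *v x i + a = lattice_point p"
    using sub unfolding triangular_lattice_eq image_subset_iff by blast
  then obtain c where c: "\<And>i. i < N \<Longrightarrow> R *v x i + a = lattice_point (c i)"
    by metis
  have "inj_on x {..<N}"
  proof (rule ccontr)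
    assume "\<not> inj_on x {..<N}"
    then obtain i j where "i < N" "j < N" "i \<noteq> j" "x i = x j"
      by (auto simp: inj_on_def)
    then have "energy V N x = \<infinity>"
      by (rule energy_coincident[OF V(2)])
    moreover have "energy V N (\<lambda>i. lattice_point (int i, 0)) \<noteq> \<infinity>"
      using energy_lattice_configuration[OF V, of "\<lambda>i. (int i, 0)" N] by (simp add: inj_on_def)
    ultimately show False
      using le[of "\<lambda>i. lattice_point (int i, 0)"] by simp
  qed
  have orth: "orthogonal_transformation (\<lambda>v. R *v v)"
    using R by (simp add: rotation_matrix_def orthogonal_transformation_matrix)
  have inj: "inj_on c {..<N}"
  proof (rule inj_onI)
    fix i j assume ij: "i \<in> {..<N}" "j \<in> {..<N}" "c i = c j"
    then have "R *v x i = R *v x j"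
      using c[of i] c[of j] by (metis add_right_cancel lessThan_iff)
    then have "x i = x j"
      using orthogonal_transformation_inj[OF orth] by (auto dest: injD)
    then show "i = j"
      using \<open>inj_on x {..<N}\<close> ij by (auto dest: inj_onD)
  qed
  have "norm (x i - x j) = norm (lattice_point (c i) - lattice_point (c j))" if "i < N" "j < N" for i j
    using orthogonal_transformation_norm[OF orth, of "x i - x j"] c[OF that(1)] c[OF that(2)]
    by (metis add_diff_cancel_right matrix_vector_mult_diff_distrib)
  then have energy_x: "energy V N x = ereal (- real (card (bond_pairs (c ` {..<N}))))"
    using energy_lattice_configuration[OF V inj] energy_cong[of N x] by metis
  have "card (bond_pairs T) \<le> card (bond_pairs (c ` {..<N}))" if T: "finite T" "card T = card (c ` {..<N})" for T
  proof -
    have "card T = N"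
      using T inj by (simp add: card_image)
    then obtain d where d: "bij_betw d {..<N} T"
      using ex_bij_betw_nat_finite[OF T(1)] by (auto simp: lessThan_atLeast0)
    then have "energy V N (\<lambda>i. lattice_point (d i)) = ereal (- real (card (bond_pairs T)))"
      using energy_lattice_configuration[OF V, of d N] by (simp add: bij_betw_def)
    then show ?thesis
      using le[of "\<lambda>i. lattice_point (d i)"] by (simp add: energy_x)
  qed
  then have "bond_maximal (c ` {..<N})"
    by (simp add: bond_maximal_def)
  with R c inj show ?thesis by blast
qed

section \<open>Weak convergence to the hexagon\<close>

lemma site_mem_scaled_hexagon:
  assumes "near_hexagon \<rho> u v S" "p \<in> S" and s: "s > 0" and t: "\<rho> / s \<le> t / sqrt 3"
  shows "lattice_map (rescaled_site s u v p) \<in> scaled_hexagon t"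
proof -
  have le: "\<bar>x / s\<bar> \<le> t / sqrt 3" if "\<bar>x\<bar> \<le> \<rho>" for x
    using divide_right_mono[OF that, of s] s t by simp
  have "rescaled_site s u v p \<in> coord_hexagon (t / sqrt 3)"
    using assms(1,2) le unfolding near_hexagon_def coord_hexagon_def rescaled_site_def
    by (simp flip: add_divide_distrib)
  then show ?thesis
    by (auto simp: scaled_hexagon_def)
qed

text \<open>In units of \<open>sqrt N\<close> the radius \<open>sqrt (N / 3) + O(N\<^sup>1\<^sup>/\<^sup>4)\<close> tends to \<open>1 / sqrt 3\<close>, so the enlargement
  factor \<open>t N\<close> in \<open>site_average_le\<close> tends to 1, while the diameter of the cells tends to 0.\<close>

lemma eventually_site_average_le:
  fixes f :: "real^2 \<Rightarrow> real"
  assumes f: "continuous_on UNIV f" and f0: "\<And>w. w \<in> scaled_hexagon 2 \<Longrightarrow> 0 \<le> f w"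
    and card: "\<And>N. N \<ge> 1 \<Longrightarrow> finite (S N) \<and> card (S N) = N"
    and near: "\<And>N. N \<ge> 1 \<Longrightarrow> near_hexagon (sqrt (N / 3) + 8 * sqrt (sqrt N)) (u N) (v N) (S N)"
    and e: "e > 0"
  shows "\<forall>\<^sub>F N in sequentially.
    (\<Sum>p\<in>S N. f (lattice_map (rescaled_site (sqrt N) (u N) (v N) p))) / N \<le> integral\<^sup>L hexagon_measure f + e"
proof -
  let ?K = "scaled_hexagon 2"
  have comp: "compact ?K" by (rule compact_scaled_hexagon)
  have cont: "continuous_on ?K f"
    using f continuous_on_subset by blast
  obtain M where M: "\<And>w. w \<in> ?K \<Longrightarrow> f w \<le> M"
    using compact_imp_bounded[OF compact_continuous_image[OF cont comp]]
    by (auto simp: bounded_real abs_le_iff)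
  \<comment> \<open>Since \<open>t N \<le> 2\<close> eventually, an oscillation of \<open>e / 8\<close> contributes at most \<open>e / 2\<close>.\<close>
  have "e / 8 > 0" using e by simp
  then obtain \<delta> where \<delta>: "\<delta> > 0"
    and unif: "\<And>w w'. w \<in> ?K \<Longrightarrow> w' \<in> ?K \<Longrightarrow> dist w' w < \<delta> \<Longrightarrow> dist (f w') (f w) < e / 8"
    using compact_uniformly_continuous[OF cont comp] unfolding uniformly_continuous_on_def by metis
  define t where "t = (\<lambda>N::nat. 1 + sqrt 3 * ((8 * sqrt (sqrt N) + 2) / sqrt N))"
  have t_lim: "t \<longlonglongrightarrow> 1"
    unfolding t_def by real_asymp
  then have "(\<lambda>N. M * ((t N)\<^sup>2 - 1)) \<longlonglongrightarrow> M * (1\<^sup>2 - 1)"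
    by (intro tendsto_intros)
  then have ev1: "\<forall>\<^sub>F N in sequentially. M * ((t N)\<^sup>2 - 1) < e / 2"
    by (rule order_tendstoD(2)) (use e in simp)
  have ev2: "\<forall>\<^sub>F N in sequentially. t N < 2"
    using t_lim by (rule order_tendstoD(2)) simp
  have "(\<lambda>N::nat. 2 / sqrt N) \<longlonglongrightarrow> 0"
    by real_asymp
  then have ev3: "\<forall>\<^sub>F N in sequentially. 2 / sqrt (real N) < \<delta>"
    using \<delta> by (rule order_tendstoD(2))
  show ?thesis
    using ev1 ev2 ev3 eventually_ge_at_top[of 1]
  proof eventually_elim
    case (elim N)
    let ?s = "sqrt (real N)" and ?\<rho> = "sqrt (N / 3) + 8 * sqrt (sqrt N)"
    have s: "?s > 0" using elim by simp
    have fin: "finite (S N)" using card elim by simp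
    have t_eq: "(?\<rho> + 2) / ?s = t N / sqrt 3"
      using s by (simp add: t_def add_divide_distrib real_sqrt_divide)
    have t1: "1 \<le> t N"
      using s by (simp add: t_def)
    have "?\<rho> / ?s \<le> t N / sqrt 3"
      unfolding t_eq[symmetric] by (rule divide_right_mono) auto
    then have site: "lattice_map (rescaled_site ?s (u N) (v N) p) \<in> ?K" if "p \<in> S N" for p
      using site_mem_scaled_hexagon[OF near that s] scaled_hexagon_mono[of "t N" 2] elim by fastforce
    have cells: "cell ?s (u N) (v N) p \<subseteq> scaled_hexagon (t N)" if "p \<in> S N" for p
      using near[of N] elim(4) that s t_eq by (intro cell_subset_scaled_hexagon) auto
    have osc: "f (lattice_map (rescaled_site ?s (u N) (v N) p)) \<le> f w + e / 8"
      if p: "p \<in> S N" and w: "w \<in> cell ?s (u N) (v N) p" for p w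
    proof -
      have "w \<in> ?K"
        using cells[OF p] w scaled_hexagon_mono[of "t N" 2] elim by auto
      moreover have "dist (lattice_map (rescaled_site ?s (u N) (v N) p)) w < \<delta>"
        using cell_dist[OF w s] elim by simp
      ultimately have "dist (f (lattice_map (rescaled_site ?s (u N) (v N) p))) (f w) < e / 8"
        using unif site[OF p] by blast
      then show ?thesis
        unfolding dist_real_def by linarith
    qed
    have "(\<Sum>p\<in>S N. f (lattice_map (rescaled_site ?s (u N) (v N) p))) / ?s\<^sup>2
      \<le> integral\<^sup>L hexagon_measure f + M * ((t N)\<^sup>2 - 1) + e / 8 * (t N)\<^sup>2"
      using elim e t1 by (intro site_average_le f f0 M fin s cells osc) auto
    moreover have "(t N)\<^sup>2 \<le> 2\<^sup>2"
      using elim t1 by (intro power_mono) auto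
    then have "e / 8 * (t N)\<^sup>2 \<le> e / 8 * 4"
      using e by (intro mult_left_mono) auto
    ultimately show ?case
      using elim by simp
  qed
qed

text \<open>The additive constant survives integration as an upper bound because the limit measure has total
  mass at most 1.\<close>

lemma integral_hexagon_affine_le:
  fixes f :: "real^2 \<Rightarrow> real"
  assumes f: "continuous_on UNIV f" and B: "B \<ge> 0"
  shows "integral\<^sup>L hexagon_measure (\<lambda>w. c * f w + B) \<le> c * integral\<^sup>L hexagon_measure f + B"
proof -
  have comp: "compact hexagon"
    by (simp add: hexagon_eq_scaled_hexagon compact_scaled_hexagon)
  have int_hex: "integrable lborel (indicator hexagon :: real^2 \<Rightarrow> real)"
    using comp emeasure_compact_finite by (auto intro!: integrable_real_indicator borel_compact)
  have int_f: "integrable lborel (\<lambda>w. indicator hexagon w * f w)"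
    using borel_integrable_compact[OF comp continuous_on_subset[OF f subset_UNIV]] by simp
  have "continuous_on UNIV (\<lambda>w. c * f w + B)"
    using f by (intro continuous_intros)
  then have "integral\<^sup>L hexagon_measure (\<lambda>w. c * f w + B) =
      2 / sqrt 3 * (LINT w|lborel. c * (indicator hexagon w * f w) + B * indicator hexagon w)"
    by (subst integral_hexagon_measure) (simp_all add: algebra_simps)
  also have "(LINT w|lborel. c * (indicator hexagon w * f w) + B * indicator hexagon w) =
      c * (LINT w|lborel. indicator hexagon w * f w) + B * measure lborel hexagon"
    using int_f int_hex by simp
  also have "2 / sqrt 3 * (c * (LINT w|lborel. indicator hexagon w * f w) + B * measure lborel hexagon) =
      c * integral\<^sup>L hexagon_measure f + B * (2 / sqrt 3 * measure lborel hexagon)"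
    unfolding integral_hexagon_measure[OF f] by (simp add: algebra_simps)
  also have "\<dots> \<le> c * integral\<^sup>L hexagon_measure f + B * 1"
    using B by (intro add_left_mono mult_left_mono measure_hexagon_le)
  finally show ?thesis by simp
qed

text \<open>The averages are taken with respect to probability measures and the total mass of the limit is at
  most 1. Hence the one-sided bound, applied to the nonnegative functions \<open>B + f\<close> and \<open>B - f\<close>, yields
  both halves of the convergence.\<close>

lemma site_average_tendsto:
  fixes f :: "real^2 \<Rightarrow> real"
  assumes f: "continuous_on UNIV f"
    and card: "\<And>N. N \<ge> 1 \<Longrightarrow> finite (S N) \<and> card (S N) = N"
    and near: "\<And>N. N \<ge> 1 \<Longrightarrow> near_hexagon (sqrt (N / 3) + 8 * sqrt (sqrt N)) (u N) (v N) (S N)"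
  shows "(\<lambda>N. (\<Sum>p\<in>S N. f (lattice_map (rescaled_site (sqrt N) (u N) (v N) p))) / N)
    \<longlonglongrightarrow> integral\<^sup>L hexagon_measure f"
proof -
  let ?avg = "\<lambda>N. (\<Sum>p\<in>S N. f (lattice_map (rescaled_site (sqrt N) (u N) (v N) p))) / N"
  have "bounded (f ` scaled_hexagon 2)"
    using f by (intro compact_imp_bounded compact_continuous_image compact_scaled_hexagon)
      (rule continuous_on_subset, auto)
  then obtain B where B: "B > 0" "\<And>w. w \<in> scaled_hexagon 2 \<Longrightarrow> \<bar>f w\<bar> \<le> B"
    by (auto simp: bounded_pos)
  have bound: "\<forall>\<^sub>F N in sequentially. c * ?avg N \<le> c * integral\<^sup>L hexagon_measure f + e"
    if c: "\<bar>c\<bar> = 1" and e: "e > 0" for c e :: real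
  proof -
    have "\<forall>\<^sub>F N in sequentially. (\<Sum>p\<in>S N. c * f (lattice_map (rescaled_site (sqrt N) (u N) (v N) p)) + B) / N
        \<le> integral\<^sup>L hexagon_measure (\<lambda>w. c * f w + B) + e"
    proof (rule eventually_site_average_le[OF _ _ card near e])
      show "continuous_on UNIV (\<lambda>w. c * f w + B)"
        using f by (intro continuous_intros)
      show "0 \<le> c * f w + B" if "w \<in> scaled_hexagon 2" for w
      proof -
        have "\<bar>c * f w\<bar> \<le> B"
          using B(2)[OF that] c by (simp add: abs_mult)
        then show ?thesis by simp
      qed
    qed
    then show ?thesis
      using eventually_ge_at_top[of 1]
    proof eventually_elim
      case (elim N)
      then have "(\<Sum>p\<in>S N. c * f (lattice_map (rescaled_site (sqrt N) (u N) (v N) p)) + B) / N = c * ?avg N + B"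
        using card[of N] by (simp add: sum.distrib sum_distrib_left add_divide_distrib)
      with elim(1) show ?case
        using integral_hexagon_affine_le[OF f, of B c] B(1) by simp
    qed
  qed
  show ?thesis
  proof (rule tendstoI)
    fix e :: real assume e: "e > 0"
    show "\<forall>\<^sub>F N in sequentially. dist (?avg N) (integral\<^sup>L hexagon_measure f) < e"
      using bound[of 1 "e/2"] bound[of "-1" "e/2"] e
      by (auto simp: dist_real_def abs_less_iff elim: eventually_elim2)
  qed
qed

lemma integral_move_empirical:
  fixes f :: "real^2 \<Rightarrow> real"
  assumes "continuous_on UNIV f"
  shows "integral\<^sup>L (move_measure R a (empirical_measure N x)) f =
    (\<Sum>i<N. f (matrix_inv R *v (x i /\<^sub>R sqrt N - a))) / N"
proof -
  have f: "f \<in> borel_measurable borel"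
    using assms by (rule borel_measurable_continuous_onI)
  have emp: "(\<lambda>i. x i /\<^sub>R sqrt (real N)) \<in> uniform_count_measure {..<N} \<rightarrow>\<^sub>M borel"
    by (auto simp: measurable_def space_uniform_count_measure sets_uniform_count_measure)
  have shift: "(\<lambda>y. matrix_inv R *v (y - a)) \<in> borel \<rightarrow>\<^sub>M borel"
    by (intro borel_measurable_continuous_onI continuous_on_compose2[OF matrix_vector_mult_linear_continuous_on[of UNIV]]
        continuous_intros subset_UNIV)
  then have shift': "(\<lambda>y. matrix_inv R *v (y - a)) \<in> empirical_measure N x \<rightarrow>\<^sub>M borel"
    by (simp add: empirical_measure_def)
  have "integral\<^sup>L (move_measure R a (empirical_measure N x)) f =
      integral\<^sup>L (empirical_measure N x) (\<lambda>y. f (matrix_inv R *v (y - a)))"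
    unfolding move_measure_def by (rule integral_distr[OF shift' f])
  also have "\<dots> = integral\<^sup>L (uniform_count_measure {..<N}) (\<lambda>i. f (matrix_inv R *v (x i /\<^sub>R sqrt N - a)))"
    unfolding empirical_measure_def
    by (rule integral_distr[OF emp measurable_compose[OF shift f]])
  finally show ?thesis
    by (simp add: integral_uniform_count_measure)
qed

lemma finite_move_empirical:
  "move_measure R a (empirical_measure N x) \<in> finite_radon_measures"
proof -
  have emp: "(\<lambda>i. x i /\<^sub>R sqrt (real N)) \<in> uniform_count_measure {..<N} \<rightarrow>\<^sub>M borel"
    by (auto simp: measurable_def space_uniform_count_measure sets_uniform_count_measure)
  have shift: "(\<lambda>y. matrix_inv R *v (y - a)) \<in> borel \<rightarrow>\<^sub>M borel"
    by (intro borel_measurable_continuous_onI continuous_on_compose2[OF matrix_vector_mult_linear_continuous_on[of UNIV]]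
        continuous_intros subset_UNIV)
  have "finite_measure (uniform_count_measure {..<N})"
    by (intro finite_measureI) (simp add: space_uniform_count_measure emeasure_uniform_count_measure)
  then have "finite_measure (empirical_measure N x)"
    unfolding empirical_measure_def by (rule finite_measure.finite_measure_distr) (rule emp)
  then have "finite_measure (move_measure R a (empirical_measure N x))"
    unfolding move_measure_def
    by (rule finite_measure.finite_measure_distr) (use shift in \<open>simp add: empirical_measure_def\<close>)
  then show ?thesis
    by (simp add: finite_radon_measures_def move_measure_def)
qed

lemma matrix_inv_transpose_rotation:
  assumes "rotation_matrix R"
  shows "matrix_inv (transpose R) = R" "rotation_matrix (transpose R)"
proof -
  have orth: "transpose R ** R = mat 1" "R ** transpose R = mat 1"
    using assms by (simp_all add: rotation_matrix_def orthogonal_matrix_def)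
  then have "transpose R ** matrix_inv (transpose R) = mat 1 \<and> matrix_inv (transpose R) ** transpose R = mat 1"
    unfolding matrix_inv_def by (intro someI_ex[where P = "\<lambda>B. transpose R ** B = mat 1 \<and> B ** transpose R = mat 1"]) blast
  then show "matrix_inv (transpose R) = R"
    using orth by (metis matrix_mul_assoc matrix_mul_lid matrix_mul_rid)
  show "rotation_matrix (transpose R)"
    using assms by (simp add: rotation_matrix_def)
qed

text \<open>The translation is chosen so that the point with lattice coordinates \<open>(u, v)\<close> becomes the origin. The
  rotation enters transposed because moving a measure applies the inverse of the rigid motion.\<close>

lemma moved_particle:
  assumes R: "rotation_matrix R" and site: "R *v z + b = lattice_point p" and s: "s > 0"
  shows "matrix_inv (transpose R) *v (z /\<^sub>R s - transpose R *v ((lattice_map (vector [u, v]) - b) /\<^sub>R s))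
    = lattice_map (rescaled_site s u v p)"
proof -
  have orth: "R ** transpose R = mat 1"
    using R by (simp add: rotation_matrix_def orthogonal_matrix_def)
  have "lattice_map (rescaled_site s u v p) = (lattice_point p - lattice_map (vector [u, v])) /\<^sub>R s"
    by (simp add: lattice_map_def rescaled_site_def lattice_point_def algebra_simps diff_divide_distrib divide_inverse)
  also have "\<dots> = (R *v z - (lattice_map (vector [u, v]) - b)) /\<^sub>R s"
    by (simp add: site[symmetric] algebra_simps)
  also have "\<dots> = R *v (z /\<^sub>R s) - R *v (transpose R *v ((lattice_map (vector [u, v]) - b) /\<^sub>R s))"
    by (simp only: matrix_vector_mul_assoc orth matrix_vector_mul_lid scaleR_diff_right matrix_vector_mult_scaleR)
  finally show ?thesis
    by (simp add: matrix_inv_transpose_rotation(1)[OF R] matrix_vector_mult_diff_distrib)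
qed

theorem theorem1p2:
  fixes V :: "real \<Rightarrow> ereal" and \<alpha> \<beta> :: real and x :: "nat \<Rightarrow> nat \<Rightarrow> real^2"
  assumes "\<And>r. 0 \<le> r \<Longrightarrow> V r \<noteq> -\<infinity>"
    and "normalized_well V"
    and "hard_core_finite_range \<alpha> \<beta> V"
    and "at_most_six_neighbours \<alpha> \<beta>"
    and "\<And>N. N \<ge> 1 \<Longrightarrow> crystallized_ground_states V N"
    and "\<And>N. N \<ge> 1 \<Longrightarrow> minimizer V N (x N)"
  shows "\<exists>(R :: nat \<Rightarrow> real^2^2) (a :: nat \<Rightarrow> real^2).
    (\<forall>N. rotation_matrix (R N)) \<and>
    weak_star_converges (\<lambda>N. move_measure (R N) (a N) (empirical_measure N (x N))) hexagon_measure"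
proof -
  have "\<exists>R b c. rotation_matrix R \<and> (N \<ge> 1 \<longrightarrow> (\<forall>i<N. R *v x N i + b = lattice_point (c i)) \<and>
      inj_on c {..<N} \<and> bond_maximal (c ` {..<N}))" for N
  proof (cases "N \<ge> 1")
    case True
    then show ?thesis
      using minimizer_bond_maximal[OF assms(2-4) assms(5,6)[of N]] by blast
  next
    case False
    have "rotation_matrix (mat 1 :: real^2^2)"
      by (simp add: rotation_matrix_def orthogonal_matrix_id)
    then show ?thesis using False by blast
  qed
  then obtain R b c where R: "\<And>N. rotation_matrix (R N)"
    and site: "\<And>N i. N \<ge> 1 \<Longrightarrow> i < N \<Longrightarrow> R N *v x N i + b N = lattice_point (c N i)"
    and inj: "\<And>N. N \<ge> 1 \<Longrightarrow> inj_on (c N) {..<N}"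
    and max: "\<And>N. N \<ge> 1 \<Longrightarrow> bond_maximal (c N ` {..<N})"
    by metis
  define S where "S = (\<lambda>N. c N ` {..<N})"
  have card: "finite (S N) \<and> card (S N) = N" if "N \<ge> 1" for N
    using inj[OF that] by (simp add: S_def card_image)
  have "\<exists>u v. N \<ge> 1 \<longrightarrow> near_hexagon (sqrt (N / 3) + 8 * sqrt (sqrt N)) u v (S N)" for N
    using bond_maximal_near_hexagon[of "S N" N] max[of N] card[of N] unfolding S_def by blast
  then obtain u v where near: "\<And>N. N \<ge> 1 \<Longrightarrow> near_hexagon (sqrt (N / 3) + 8 * sqrt (sqrt N)) (u N) (v N) (S N)"
    by metis
  define R' where "R' = (\<lambda>N. transpose (R N))"
  define a where "a = (\<lambda>N. R' N *v ((lattice_map (vector [u N, v N]) - b N) /\<^sub>R sqrt N))"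
  let ?M = "\<lambda>N. move_measure (R' N) (a N) (empirical_measure N (x N))"
  have "(\<lambda>N. integral\<^sup>L (?M N) f) \<longlonglongrightarrow> integral\<^sup>L hexagon_measure f" if "f \<in> C0" for f
  proof -
    have f: "continuous_on UNIV f"
      using that by (simp add: C0_def)
    have "integral\<^sup>L (?M N) f = (\<Sum>p\<in>S N. f (lattice_map (rescaled_site (sqrt N) (u N) (v N) p))) / N"
      if N: "N \<ge> 1" for N
    proof -
      have "matrix_inv (R' N) *v (x N i /\<^sub>R sqrt N - a N) = lattice_map (rescaled_site (sqrt N) (u N) (v N) (c N i))"
        if "i < N" for i
        unfolding a_def R'_def using N that by (intro moved_particle R site) auto
      then show ?thesis
        using inj[OF N] by (simp add: integral_move_empirical[OF f] S_def sum.reindex)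
    qed
    then have "\<forall>\<^sub>F N in sequentially.
        (\<Sum>p\<in>S N. f (lattice_map (rescaled_site (sqrt N) (u N) (v N) p))) / N = integral\<^sup>L (?M N) f"
      by (intro eventually_sequentiallyI[of 1]) simp
    moreover have "(\<lambda>N. (\<Sum>p\<in>S N. f (lattice_map (rescaled_site (sqrt N) (u N) (v N) p))) / N)
        \<longlonglongrightarrow> integral\<^sup>L hexagon_measure f"
      using f card near by (rule site_average_tendsto)
    ultimately show ?thesis
      by (rule Lim_transform_eventually[rotated])
  qed
  then have "weak_star_converges ?M hexagon_measure"
    by (simp add: weak_star_converges_def finite_move_empirical finite_hexagon_measure)
  moreover have "\<forall>N. rotation_matrix (R' N)"
    using matrix_inv_transpose_rotation(2)[OF R] by (simp add: R'_def)
  ultimately show ?thesis by blast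
qed

end
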